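(* Let $C$ be a unicuspidal monomial curve of arithmetic genus $g\geq 4$ over an algebraically closed field $k$, with semigroup $\mathrm{S}$, set of gaps $\mathrm{G}$, and Frobenius number $\gamma$. Let $\mathscr{F}:=\mathcal{O}\langle 1,t^{a_1},\ldots,t^{a_n}\rangle$ with $n\geq 1$ and $0<a_1<\cdots<a_n$ integers. Consider the set $$\mathrm{G}':=\Big\{\ell\in\mathrm{G}\ \Big|\ \ell>a_n\ \text{and}\ \ell\notin\bigcup_{i=1}^n(a_i+\mathrm{S})\Big\}.$$ Then $$\mathrm{Hom}(\mathscr{F},\omega)=\langle t^i\mid i\in\gamma-\mathrm{G}'\rangle,$$ the $k$-linear span of the $t^i$ with $i\in\gamma-\mathrm{G}':=\{\gamma-\ell\mid\ell\in\mathrm{G}'\}$. In particular, $$h^1(\mathscr{F})=\#(\mathrm{G}'),$$ and $\mathscr{F}$ contributes to the Clifford index if and only if $\#(\mathrm{G}')\geq 2$.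
   Context: A monomial curve $C=(1:t^{n_1}:\cdots:t^{n_m})$ is the image of the map $\mathbb{P}^1\to\mathbb{P}^m$, $(s:t)\mapsto(s^{n_m}:s^{n_m-n_1}t^{n_1}:\cdots:s^{n_m-n_{m-1}}t^{n_{m-1}}:t^{n_m})$, $0<n_1<\cdots<n_m$. It is unicuspidal if it has exactly one singular point and this point is unibranch; by convention the singular point is $P=(1:0:\cdots:0)$, so $n_1\geq 2$, and the point at infinity $Q=(0:\cdots:0:1)$ is regular, i.e. $n_m=n_{m-1}+1$. The function field of $C$ is $k(t)$. Let $v$ be the valuation of $k(t)$ at $t=0$ (the point of the normalization over $P$). The semigroup of $C$ is $\mathrm{S}:=v(\mathcal{O}_P)\subset\mathbb{N}$ (values of nonzero elements); its set of gaps is $\mathrm{G}:=\mathbb{N}\setminus\mathrm{S}$ and its Frobenius number $\gamma$ is the largest gap. For $f_1,\ldots,f_n\in k(C)$, $\mathcal{O}\langle f_1,\ldots,f_n\rangle$ is the subsheaf of the constant sheaf of rational functions $\mathscr{K}$ generated by the $f_i$, with stalks $f_1\mathcal{O}_R+\cdots+f_n\mathcal{O}_R$, $R\in C$. The dualizing sheaf $\omega$ is regarded as the subsheaf of $\mathscr{K}$ generated by its global sections, embedded so that $H^0(\omega)$ is the $k$-span of $\{t^i\mid i\in\gamma-\mathrm{G}\}$. With this, $\mathrm{Hom}(\mathscr{F},\omega)$ is identified with $\{f\in k(C)\mid f\mathscr{F}\subset\omega\}$. A torsion-free sheaf $\mathscr{F}$ of rank $1$ contributes to the Clifford index if $h^0(\mathscr{F})\geq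 2$ and $h^1(\mathscr{F})\geq 2$. *)

theory Defs
  imports
    "HOL-Computational_Algebra.Computational_Algebra"
    "HOL-Library.Extended_Nat"
    "HOL-Library.FuncSet"
    "HOL-Library.Function_Algebras"
begin

section \<open>The field of rational functions in one variable\<close>

type_synonym 'a ratfun = "'a poly fract"

definition const :: "'a::field \<Rightarrow> 'a ratfun" where
  "const c = to_fract [:c:]"

definition tt :: "'a::field ratfun" where
  "tt = to_fract [:0, 1:]"

definition smul :: "'a::field \<Rightarrow> 'a ratfun \<Rightarrow> 'a ratfun" where
  "smul c f = const c * f"

text \<open>The valuation at \<open>t = 0\<close>; only meaningful for \<open>f \<noteq> 0\<close>.\<close>

definition val0 :: "'a::field ratfun \<Rightarrow> int" where
  "val0 f = (THE i. \<exists>p q. poly p 0 \<noteq> 0 \<and> poly q 0 \<noteq> 0 \<and>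
                      f = tt powi i * (to_fract p / to_fract q))"


section \<open>Dimensions\<close>

text \<open>
  \<open>quot_dim scale V W\<close> is the dimension of \<open>V / W\<close> for subspaces \<open>W \<subseteq> V\<close>: the supremum of the
  sizes of finite subsets of \<open>V\<close> whose classes modulo \<open>W\<close> are linearly independent. It is
  \<open>\<infinity>\<close> if the quotient is infinite-dimensional.
\<close>

definition quot_dim ::
  "('a::zero \<Rightarrow> 'v \<Rightarrow> 'v) \<Rightarrow> 'v::comm_monoid_add set \<Rightarrow> 'v set \<Rightarrow> enat" where
  "quot_dim scale V W =
     Sup {enat (card B) | B. finite B \<and> B \<subseteq> V \<and>
            (\<forall>c. (\<Sum>b\<in>B. scale (c b) b) \<in> W \<longrightarrow> (\<forall>b\<in>B. c b = 0))}"


section \<open>Projective space and homogeneous forms\<close>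

text \<open>
  A point of projective \<open>m\<close>-space is the set of all its vectors of homogeneous coordinates
  \<open>(x\<^sub>0, \<dots>, x\<^sub>m)\<close>; such a vector is a function on \<open>nat\<close> that vanishes beyond \<open>m\<close>.
\<close>

type_synonym 'a ppoint = "(nat \<Rightarrow> 'a) set"

definition hvec :: "nat \<Rightarrow> (nat \<Rightarrow> 'a::field) set" where
  "hvec m = {x. (\<exists>i. x i \<noteq> 0) \<and> (\<forall>i>m. x i = 0)}"

definition proj :: "(nat \<Rightarrow> 'a::field) \<Rightarrow> 'a ppoint" where
  "proj x = {(\<lambda>i. c * x i) | c. c \<noteq> 0}"

definition multi_indices :: "nat \<Rightarrow> nat \<Rightarrow> (nat \<Rightarrow> nat) set" where
  "multi_indices m d = {\<alpha> \<in> {..m} \<rightarrow>\<^sub>E {..d}. (\<Sum>i\<le>m. \<alpha> i) = d}"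

text \<open>
  The value at \<open>x\<close> of the form of degree \<open>d\<close> in \<open>x\<^sub>0, \<dots>, x\<^sub>m\<close> with coefficients \<open>c\<close>.
\<close>

definition form_eval ::
  "nat \<Rightarrow> nat \<Rightarrow> ((nat \<Rightarrow> nat) \<Rightarrow> 'b::comm_ring_1) \<Rightarrow> (nat \<Rightarrow> 'b) \<Rightarrow> 'b" where
  "form_eval m d c x = (\<Sum>\<alpha>\<in>multi_indices m d. c \<alpha> * (\<Prod>i\<le>m. x i ^ \<alpha> i))"


section \<open>Monomial curves\<close>

text \<open>
  A monomial curve is given by \<open>m\<close> and exponents \<open>0 = \<nu> 0 < \<nu> 1 < \<dots> < \<nu> m\<close>; the value \<open>\<nu> 0 = 0\<close>
  is the exponent of the coordinate \<open>x\<^sub>0\<close>. \<open>param m \<nu>\<close> is the parametrization, applied to a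
  vector \<open>(s, t) = (x 0, x 1)\<close> of homogeneous coordinates on the projective line.
\<close>

definition param :: "nat \<Rightarrow> (nat \<Rightarrow> nat) \<Rightarrow> (nat \<Rightarrow> 'a::field) \<Rightarrow> 'a ppoint" where
  "param m \<nu> x = proj (\<lambda>i. if i \<le> m then x 0 ^ (\<nu> m - \<nu> i) * x 1 ^ \<nu> i else 0)"

definition curve :: "nat \<Rightarrow> (nat \<Rightarrow> nat) \<Rightarrow> 'a::field ppoint set" where
  "curve m \<nu> = param m \<nu> ` hvec 1"

text \<open>The value of a form over \<open>k\<close> at the generic point \<open>(1 : t^\<nu>\<^sub>1 : \<dots> : t^\<nu>\<^sub>m)\<close>.\<close>

definition generic_eval ::
  "nat \<Rightarrow> (nat \<Rightarrow> nat) \<Rightarrow> nat \<Rightarrow> ((nat \<Rightarrow> nat) \<Rightarrow> 'a::field) \<Rightarrow> 'a ratfun" where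
  "generic_eval m \<nu> d F = form_eval m d (\<lambda>\<alpha>. const (F \<alpha>)) (\<lambda>i. tt ^ \<nu> i)"

definition function_field :: "nat \<Rightarrow> (nat \<Rightarrow> nat) \<Rightarrow> 'a::field ratfun set" where
  "function_field m \<nu> =
     {generic_eval m \<nu> d F / generic_eval m \<nu> d G | d F G. generic_eval m \<nu> d G \<noteq> 0}"

definition local_ring :: "nat \<Rightarrow> (nat \<Rightarrow> nat) \<Rightarrow> 'a::field ppoint \<Rightarrow> 'a ratfun set" where
  "local_ring m \<nu> R =
     {generic_eval m \<nu> d F / generic_eval m \<nu> d G | d F G. \<forall>x\<in>R. form_eval m d G x \<noteq> 0}"

definition max_ideal :: "nat \<Rightarrow> (nat \<Rightarrow> nat) \<Rightarrow> 'a::field ppoint \<Rightarrow> 'a ratfun set" where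
  "max_ideal m \<nu> R =
     {f \<in> local_ring m \<nu> R. \<not> (\<exists>g\<in>local_ring m \<nu> R. f * g = 1)}"

text \<open>The local rings are one-dimensional, so regularity means that one element generates the
  maximal ideal.\<close>

definition regular_point :: "nat \<Rightarrow> (nat \<Rightarrow> nat) \<Rightarrow> 'a::field ppoint \<Rightarrow> bool" where
  "regular_point m \<nu> R \<longleftrightarrow>
     (\<exists>h\<in>local_ring m \<nu> R. max_ideal m \<nu> R = (\<lambda>f. h * f) ` local_ring m \<nu> R)"

text \<open>For a curve with function field \<open>k(t)\<close>, \<open>param\<close> is the normalization map, so the branches
  at \<open>R\<close> are the points of the projective line lying over \<open>R\<close>.\<close>

definition branches :: "nat \<Rightarrow> (nat \<Rightarrow> nat) \<Rightarrow> 'a::field ppoint \<Rightarrow> 'a ppoint set" where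
  "branches m \<nu> R = proj ` {x \<in> hvec 1. param m \<nu> x = R}"

definition unibranch :: "nat \<Rightarrow> (nat \<Rightarrow> nat) \<Rightarrow> 'a::field ppoint \<Rightarrow> bool" where
  "unibranch m \<nu> R \<longleftrightarrow> (\<exists>q. branches m \<nu> R = {q})"

definition pointP :: "'a::field ppoint" where
  "pointP = proj (\<lambda>i. if i = 0 then 1 else 0)"

text \<open>The condition on the function field says that the parametrization is birational.\<close>

definition monomial_curve :: "'a::field itself \<Rightarrow> nat \<Rightarrow> (nat \<Rightarrow> nat) \<Rightarrow> bool" where
  "monomial_curve _ m \<nu> \<longleftrightarrow>
     m \<ge> 1 \<and> \<nu> 0 = 0 \<and> strict_mono_on {..m} \<nu> \<and>
     function_field m \<nu> = (UNIV :: 'a ratfun set)"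

definition unicuspidal :: "'a::field itself \<Rightarrow> nat \<Rightarrow> (nat \<Rightarrow> nat) \<Rightarrow> bool" where
  "unicuspidal _ m \<nu> \<longleftrightarrow>
     {R \<in> curve m \<nu>. \<not> regular_point m \<nu> R} = {pointP :: 'a ppoint} \<and>
     unibranch m \<nu> (pointP :: 'a ppoint)"

definition semigroup_of :: "'a::field itself \<Rightarrow> nat \<Rightarrow> (nat \<Rightarrow> nat) \<Rightarrow> nat set" where
  "semigroup_of _ m \<nu> =
     {j. \<exists>f \<in> local_ring m \<nu> (pointP :: 'a ppoint). f \<noteq> 0 \<and> val0 f = int j}"

definition gaps :: "'a::field itself \<Rightarrow> nat \<Rightarrow> (nat \<Rightarrow> nat) \<Rightarrow> nat set" where
  "gaps k m \<nu> = UNIV - semigroup_of k m \<nu>"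

definition frobenius :: "'a::field itself \<Rightarrow> nat \<Rightarrow> (nat \<Rightarrow> nat) \<Rightarrow> nat" where
  "frobenius k m \<nu> = Max (gaps k m \<nu>)"


section \<open>Subsheaves of the constant sheaf of rational functions\<close>

text \<open>
  A subsheaf of the constant sheaf \<open>K\<close> of rational functions is given by its stalks. Only the
  stalks at points of the curve matter.
\<close>

type_synonym 'a subsheaf = "'a ppoint \<Rightarrow> 'a ratfun set"

definition gen_sheaf ::
  "nat \<Rightarrow> (nat \<Rightarrow> nat) \<Rightarrow> 'a::field ratfun set \<Rightarrow> 'a subsheaf" where
  "gen_sheaf m \<nu> B R = {(\<Sum>b\<in>B. g b * b) | g. \<forall>b\<in>B. g b \<in> local_ring m \<nu> R}"

definition H0 :: "nat \<Rightarrow> (nat \<Rightarrow> nat) \<Rightarrow> 'a::field subsheaf \<Rightarrow> 'a ratfun set" where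
  "H0 m \<nu> \<F> = {f. \<forall>R\<in>curve m \<nu>. f \<in> \<F> R}"

definition h0 :: "nat \<Rightarrow> (nat \<Rightarrow> nat) \<Rightarrow> 'a::field subsheaf \<Rightarrow> enat" where
  "h0 m \<nu> \<F> = quot_dim smul (H0 m \<nu> \<F>) {0}"

text \<open>
  For a coherent nonzero \<open>\<F>\<close>, the sequence \<open>0 \<rightarrow> \<F> \<rightarrow> K \<rightarrow> K/\<F> \<rightarrow> 0\<close> is a flasque resolution and
  \<open>K/\<F>\<close> is the direct sum of the skyscraper sheaves \<open>K/\<F>\<^sub>R\<close>, so that the first cohomology of \<open>\<F>\<close> is
  the cokernel of the map from \<open>K\<close> to the direct sum of the \<open>K/\<F>\<^sub>R\<close>. An element of the direct sum
  is represented by a family \<open>r\<close> with \<open>r R \<in> \<F> R\<close> for almost all \<open>R\<close>. The quotient of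
  \<open>finite_families\<close> by \<open>principal_families\<close> is the cokernel: two families have the same class iff
  their difference agrees, modulo the stalks, with a single rational function.
\<close>

definition finite_families ::
  "nat \<Rightarrow> (nat \<Rightarrow> nat) \<Rightarrow> 'a::field subsheaf \<Rightarrow> ('a ppoint \<Rightarrow> 'a ratfun) set" where
  "finite_families m \<nu> \<F> = {r. finite {R \<in> curve m \<nu>. r R \<notin> \<F> R}}"

definition principal_families ::
  "nat \<Rightarrow> (nat \<Rightarrow> nat) \<Rightarrow> 'a::field subsheaf \<Rightarrow> ('a ppoint \<Rightarrow> 'a ratfun) set" where
  "principal_families m \<nu> \<F> = {r. \<exists>f. \<forall>R\<in>curve m \<nu>. r R - f \<in> \<F> R}"

definition h1 :: "nat \<Rightarrow> (nat \<Rightarrow> nat) \<Rightarrow> 'a::field subsheaf \<Rightarrow> enat" where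
  "h1 m \<nu> \<F> = quot_dim (\<lambda>c r R. smul c (r R)) (finite_families m \<nu> \<F>) (principal_families m \<nu> \<F>)"

definition arith_genus :: "'a::field itself \<Rightarrow> nat \<Rightarrow> (nat \<Rightarrow> nat) \<Rightarrow> enat" where
  "arith_genus _ m \<nu> = h1 m \<nu> (local_ring m \<nu> :: 'a subsheaf)"

text \<open>
  The dualizing sheaf, embedded in \<open>K\<close> so that its global sections are spanned by the
  \<open>t^(\<gamma> - \<ell>)\<close> with \<open>\<ell>\<close> a gap, and generated by these. The natural subtraction is exact because
  \<open>\<gamma>\<close> is the largest gap.
\<close>

definition dualizing :: "nat \<Rightarrow> (nat \<Rightarrow> nat) \<Rightarrow> 'a::field subsheaf" where
  "dualizing m \<nu> =
     gen_sheaf m \<nu> ((\<lambda>l. tt ^ (frobenius TYPE('a) m \<nu> - l)) ` gaps TYPE('a) m \<nu>)"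

definition Hom_sheaf ::
  "nat \<Rightarrow> (nat \<Rightarrow> nat) \<Rightarrow> 'a::field subsheaf \<Rightarrow> 'a subsheaf \<Rightarrow> 'a ratfun set" where
  "Hom_sheaf m \<nu> \<F> \<G> = {f. \<forall>R\<in>curve m \<nu>. \<forall>g\<in>\<F> R. f * g \<in> \<G> R}"

definition contributes_to_Clifford ::
  "nat \<Rightarrow> (nat \<Rightarrow> nat) \<Rightarrow> 'a::field subsheaf \<Rightarrow> bool" where
  "contributes_to_Clifford m \<nu> \<F> \<longleftrightarrow> h0 m \<nu> \<F> \<ge> 2 \<and> h1 m \<nu> \<F> \<ge> 2"

end

theory Submission
  imports Defs
begin

text \<open>
  Regularity at infinity forces two consecutive exponents \<open>\<nu> m = \<nu> i + 1\<close>; hence the local rings away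
  from the cusp are those of the projective line, and the one at the cusp consists of all quotients
  of polynomials with exponents in the semigroup \<open>S\<close>. Every sheaf in question is therefore cut
  out by three conditions: regularity at the points \<open>c \<noteq> 0, \<infinity>\<close>, a bound on the degree at infinity,
  and a set of exponents allowed at the cusp. A section of \<open>Hom(F, \<omega>)\<close> is regular at every \<open>c \<noteq> 0\<close>,
  so it is a Laurent polynomial and the remaining conditions apply monomial by monomial. For \<open>h\<^sup>1\<close>, partial
  fractions reduce a family of principal parts to one at the cusp, where exactly the \<open>t^l\<close> with
  \<open>l \<in> G'\<close> survive.
\<close>

section \<open>Polynomials with prescribed exponents\<close>

text \<open>\<open>unicuspidal\<close> only says which point fails to be regular, so the relation
  between the top exponents has to be extracted from the local ring at infinity. It matters because
  local rings consist of quotients of forms of equal degree on the embedded curve, and not every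
  polynomial in t is such a form; two consecutive exponents supply all large exponents and all
  exponents near the top of each degree. Let E be the union of S and all a_i + S, the exponents of F
  at the cusp. The degree of F at infinity is bounded by a_n, and G' is exactly the set of l > a_n
  outside E. An exponent i is allowed in \<omega> at the cusp iff \<gamma> - i, read as an integer,
  is outside S. So t^i carries the generators of F to allowed exponents at the cusp iff \<gamma> - i
  avoids E, and the bound a_n + i \<le> \<gamma> - 1 at infinity says \<gamma> - i > a_n. First
  cohomology is computed from its cokernel description, not by duality. For \<omega> only upper
  bounds of the stalks are established; the reverse inclusion for Hom is checked on generators.
  Algebraic closedness enters because a denominator with no root other than 0 is a constant times a
  power of t.\<close>

definition supported :: "nat set \<Rightarrow> 'a::field poly set" where
  "supported E = {p. \<forall>i. coeff p i \<noteq> 0 \<longrightarrow> i \<in> E}"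

lemma supported_0 [simp]: "0 \<in> supported E"
  by (simp add: supported_def)

lemma supported_UNIV [simp]: "supported UNIV = UNIV"
  by (simp add: supported_def)

lemma supported_mono: "p \<in> supported E \<Longrightarrow> E \<subseteq> E' \<Longrightarrow> p \<in> supported E'"
  by (auto simp: supported_def)

lemma supported_add: "p \<in> supported E \<Longrightarrow> q \<in> supported E \<Longrightarrow> p + q \<in> supported E"
  unfolding supported_def by (simp, metis add.right_neutral)

lemma supported_monom: "i \<in> E \<Longrightarrow> monom c i \<in> supported E"
  by (simp add: supported_def)

lemma supported_const: "0 \<in> E \<Longrightarrow> [:c:] \<in> supported E"
  by (simp add: supported_monom flip: monom_0)

lemma supported_1: "0 \<in> E \<Longrightarrow> 1 \<in> supported E"
  using supported_const[of E 1] by (simp add: one_pCons)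

lemma supported_mult:
  assumes "p \<in> supported A" "q \<in> supported B" "\<And>i j. i \<in> A \<Longrightarrow> j \<in> B \<Longrightarrow> i + j \<in> E"
  shows "p * q \<in> supported E"
  unfolding supported_def
proof safe
  fix i assume "coeff (p * q) i \<noteq> 0"
  then obtain j where "j \<le> i" "coeff p j * coeff q (i - j) \<noteq> 0"
    by (auto simp: coeff_mult elim: sum.not_neutral_contains_not_neutral)
  then show "i \<in> E"
    using assms(1,2) assms(3)[of j "i - j"] by (auto simp: supported_def)
qed

text \<open>Compare coefficients at the smallest exponent of \<open>h\<close> outside \<open>E\<close>.\<close>

lemma supported_cancel:
  assumes "q * h \<in> supported E" "q \<in> supported S" "coeff q 0 \<noteq> 0"
    and "\<And>s e. s \<in> S \<Longrightarrow> e \<in> E \<Longrightarrow> s + e \<in> E"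
  shows "h \<in> supported E"
proof -
  have "coeff h i \<noteq> 0 \<Longrightarrow> i \<in> E" for i
  proof (induction i rule: less_induct)
    case (less i)
    show ?case
    proof (rule ccontr)
      assume "i \<notin> E"
      have "coeff (q * h) i = (\<Sum>j\<le>i. coeff q j * coeff h (i - j))"
        by (rule coeff_mult)
      \<comment> \<open>A nonzero term with j > 0 would give i - j in E by induction and j in S,
        hence i in E.\<close>
      also have "\<dots> = (\<Sum>j\<in>{0}. coeff q j * coeff h (i - j))"
      proof (rule sum.mono_neutral_right)
        show "\<forall>j\<in>{..i} - {0}. coeff q j * coeff h (i - j) = 0"
        proof
          fix j assume "j \<in> {..i} - {0}"
          then have j: "0 < j" "j \<le> i" by auto
          show "coeff q j * coeff h (i - j) = 0"
          proof (rule ccontr)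
            assume *: "coeff q j * coeff h (i - j) \<noteq> 0"
            then have "i - j \<in> E" using less.IH[of "i - j"] j by auto
            moreover have "j \<in> S" using * assms(2) by (auto simp: supported_def)
            ultimately have "j + (i - j) \<in> E" using assms(4) by blast
            with j \<open>i \<notin> E\<close> show False by simp
          qed
        qed
      qed auto
      also have "\<dots> \<noteq> 0" using assms(3) less.prems by simp
      finally show False using assms(1) \<open>i \<notin> E\<close> by (auto simp: supported_def)
    qed
  qed
  then show ?thesis by (auto simp: supported_def)
qed

text \<open>Synthetic division by the linear factor inverts \<open>q\<close> modulo its first power.
  Multiplying the remaining term b * [:-c, 1:]^M by that identity raises the power by one. The
  result provides inverses of denominators modulo arbitrarily high powers.\<close>

lemma bezout_linear_power:
  fixes q :: "'a::field poly"
  assumes "poly q c \<noteq> 0"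
  shows "\<exists>a b. a * q + b * [:-c, 1:] ^ M = 1"
proof (induction M)
  case 0
  show ?case by (rule exI[of _ 0], rule exI[of _ 1]) simp
next
  case (Suc M)
  then obtain a b where ab: "a * q + b * [:-c, 1:] ^ M = 1" by blast
  define s where "s = smult (inverse (poly q c)) (synthetic_div q c)"
  define l where "l = [:inverse (poly q c):]"
  have "q = [:-c, 1:] * synthetic_div q c + [:poly q c:]"
    by (rule synthetic_div_correct'[symmetric])
  then have "l * q = l * ([:-c, 1:] * synthetic_div q c + [:poly q c:])" by (rule arg_cong)
  also have "\<dots> = [:-c, 1:] * s + 1"
    using assms by (simp add: l_def s_def distrib_left one_pCons del: mult_pCons_left mult_pCons_right) simp
  finally have l: "l * q - [:-c, 1:] * s = 1" by simp
  have "1 = a * q + b * [:-c, 1:] ^ M * (l * q - [:-c, 1:] * s)"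
    using ab l by simp
  also have "\<dots> = (a + b * [:-c, 1:] ^ M * l) * q + (- b * s) * [:-c, 1:] ^ Suc M"
    by (simp only: power_Suc) (simp add: algebra_simps del: mult_pCons_left mult_pCons_right)
  finally show ?case by metis
qed


section \<open>Rational functions\<close>

lemma to_fract_power: "to_fract (p ^ n) = to_fract p ^ n"
  by (induction n) auto

lemma tt_power: "tt ^ n = to_fract (monom 1 n)"
proof -
  have "[:0, 1:] = monom (1::'a) 1" by (simp add: monom_Suc)
  then show ?thesis by (simp add: tt_def monom_power flip: to_fract_power)
qed

lemma tt_nonzero [simp]: "tt \<noteq> 0"
  by (simp add: tt_def)

lemma const_1 [simp]: "const 1 = 1"
  using to_fract_1 by (simp add: const_def flip: one_pCons)

lemma const_0 [simp]: "const 0 = 0"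
  by (simp add: const_def)

lemma smul_tt_power: "smul c (tt ^ n) = to_fract (monom c n)"
  by (simp add: smul_def const_def tt_power smult_monom flip: to_fract_mult)

lemma module_smul: "module (smul :: 'a::field \<Rightarrow> 'a ratfun \<Rightarrow> 'a ratfun)"
proof
  fix a b :: 'a and x y :: "'a ratfun"
  have "[:a + b:] = [:a:] + [:b:]" "[:a * b:] = [:a:] * [:b:]" by simp_all
  then have "const (a + b) = const a + const b" "const (a * b) = const a * const b"
    unfolding const_def by (simp_all only: to_fract_add to_fract_mult)
  then show "smul (a + b) x = smul a x + smul b x" "smul a (smul b x) = smul (a * b) x"
    by (simp_all add: smul_def algebra_simps)
  show "smul a (x + y) = smul a x + smul a y" "smul 1 x = x"
    by (simp_all add: smul_def algebra_simps)
qed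

lemma ratfun_cases:
  obtains p q where "f = to_fract p / to_fract q" "q \<noteq> (0 :: 'a::field poly)"
  by (cases f) (auto simp: Fract_conv_to_fract)

lemma fract_eq_iff:
  "q \<noteq> 0 \<Longrightarrow> q' \<noteq> 0 \<Longrightarrow>
     to_fract p / to_fract q = to_fract p' / to_fract q' \<longleftrightarrow> p * q' = p' * q"
  by (simp add: frac_eq_eq flip: to_fract_mult)

lemma fract_add:
  "q \<noteq> 0 \<Longrightarrow> q' \<noteq> 0 \<Longrightarrow>
     to_fract p / to_fract q + to_fract p' / to_fract q' =
       to_fract (p * q' + p' * q) / to_fract (q * q')"
  using add_frac_eq[of "to_fract q" "to_fract q'" "to_fract p" "to_fract p'"] by simp

lemma fract_mult:
  "(to_fract p / to_fract q) * (to_fract p' / to_fract q') = to_fract (p * p') / to_fract (q * q')"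
  by simp

text \<open>This justifies the definite description in \<open>val0\<close>. If two exponents
  represented the same function, cancelling the smaller power of t would leave an identity of
  polynomials with exactly one side vanishing at 0.\<close>

lemma val0_monomial_mult:
  fixes p q :: "'a::field poly"
  assumes "poly p 0 \<noteq> 0" "poly q 0 \<noteq> 0"
  shows "val0 (tt powi i * (to_fract p / to_fract q)) = i"
proof -
  have *: "i \<le> j" if nz: "poly p 0 \<noteq> 0" "poly q 0 \<noteq> 0" "poly p' 0 \<noteq> 0" "poly q' 0 \<noteq> 0"
    and eq: "tt powi i * (to_fract p / to_fract q) = tt powi j * (to_fract p' / to_fract q')"
    for i j :: int and p q p' q' :: "'a poly"
  proof (rule ccontr)
    assume "\<not> i \<le> j"
    define n where "n = nat (i - j)"
    have n: "i = j + int n" "n > 0" using \<open>\<not> i \<le> j\<close> by (auto simp: n_def)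
    have q0: "q \<noteq> 0" "q' \<noteq> 0" using nz by auto
    have "tt powi i = tt powi j * (tt ^ n :: 'a ratfun)"
      by (simp add: n power_int_add)
    with eq have "tt powi j * (tt ^ n * (to_fract p / to_fract q)) =
        tt powi j * (to_fract p' / to_fract q')"
      by (simp only: mult.assoc)
    then have "tt ^ n * (to_fract p / to_fract q) = to_fract p' / to_fract q'"
      by (subst (asm) mult_cancel_left) (simp add: power_int_eq_0_iff)
    then have "to_fract (monom 1 n * p) / to_fract q = to_fract p' / to_fract q'"
      by (simp add: tt_power)
    then have "monom 1 n * p * q' = p' * q"
      using q0 fract_eq_iff by blast
    then have "poly (monom 1 n * p * q') 0 = poly (p' * q) 0" by simp
    then show False using nz n by (simp add: poly_monom zero_power)
  qed
  show ?thesis unfolding val0_def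
  proof (rule the_equality)
    show "\<exists>p' q'. poly p' 0 \<noteq> 0 \<and> poly q' 0 \<noteq> 0 \<and>
      tt powi i * (to_fract p / to_fract q) = tt powi i * (to_fract p' / to_fract q')"
      using assms by blast
  next
    fix j assume "\<exists>p' q'. poly p' 0 \<noteq> 0 \<and> poly q' 0 \<noteq> 0 \<and>
      tt powi i * (to_fract p / to_fract q) = tt powi j * (to_fract p' / to_fract q')"
    then obtain p' q' where "poly p' 0 \<noteq> 0" "poly q' 0 \<noteq> 0"
      and eq: "tt powi i * (to_fract p / to_fract q) = tt powi j * (to_fract p' / to_fract q')"
      by blast
    then show "j = i"
      using *[OF assms, of p' q' i j] *[of p' q' p q j i] assms by force
  qed
qed

section \<open>Stalks\<close>

text \<open>Numerators and denominators have separate exponent sets. The denominators are the units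
  of the local ring with semigroup \<open>S\<close>; the set \<open>E\<close>, when stable under
  adding \<open>S\<close>, describes a module over that ring. The choice \<open>E = S\<close> is the
  ring itself, and other choices describe F and bound the dualizing sheaf.\<close>

definition stalk_cusp :: "nat set \<Rightarrow> nat set \<Rightarrow> 'a::field ratfun set" where
  "stalk_cusp S E =
     {to_fract p / to_fract q | p q. p \<in> supported E \<and> q \<in> supported S \<and> coeff q 0 \<noteq> 0}"

definition stalk_affine :: "'a::field \<Rightarrow> 'a ratfun set" where
  "stalk_affine c = {to_fract p / to_fract q | p q. poly q c \<noteq> 0}"

text \<open>Rational functions with a pole of order at most \<open>b\<close> at infinity; natural
  subtraction is avoided by adding \<open>b\<close> to the degree of the denominator.\<close>

definition stalk_infinity :: "nat \<Rightarrow> 'a::field ratfun set" where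
  "stalk_infinity b = {to_fract p / to_fract q | p q. q \<noteq> 0 \<and> degree p \<le> degree q + b}"

lemma stalk_cuspI:
  "p \<in> supported E \<Longrightarrow> q \<in> supported S \<Longrightarrow> coeff q 0 \<noteq> 0 \<Longrightarrow>
     to_fract p / to_fract q \<in> stalk_cusp S E"
  unfolding stalk_cusp_def by blast

lemma stalk_cuspE:
  assumes "f \<in> stalk_cusp S E"
  obtains p q where "f = to_fract p / to_fract q" "p \<in> supported E" "q \<in> supported S"
    "coeff q 0 \<noteq> 0"
  using assms unfolding stalk_cusp_def by blast

lemma stalk_affineI: "poly q c \<noteq> 0 \<Longrightarrow> to_fract p / to_fract q \<in> stalk_affine c"
  unfolding stalk_affine_def by blast

lemma stalk_affineE:
  assumes "f \<in> stalk_affine c"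
  obtains p q where "f = to_fract p / to_fract q" "poly q c \<noteq> 0"
  using assms unfolding stalk_affine_def by blast

lemma stalk_infinityI:
  "q \<noteq> 0 \<Longrightarrow> degree p \<le> degree q + b \<Longrightarrow> to_fract p / to_fract q \<in> stalk_infinity b"
  unfolding stalk_infinity_def by blast

lemma stalk_infinityE:
  assumes "f \<in> stalk_infinity b"
  obtains p q where "f = to_fract p / to_fract q" "q \<noteq> 0" "degree p \<le> degree q + b"
  using assms unfolding stalk_infinity_def by blast

lemma stalk_cusp_add:
  assumes "f \<in> stalk_cusp S E" "g \<in> stalk_cusp S E"
    and "\<And>s e. s \<in> S \<Longrightarrow> e \<in> E \<Longrightarrow> s + e \<in> E" "\<And>s e. s \<in> S \<Longrightarrow> e \<in> S \<Longrightarrow> s + e \<in> S"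
  shows "f + g \<in> stalk_cusp S E"
proof -
  from assms(1) obtain p q where 1: "f = to_fract p / to_fract q" "p \<in> supported E"
    "q \<in> supported S" "coeff q 0 \<noteq> 0" by (rule stalk_cuspE)
  from assms(2) obtain p' q' where 2: "g = to_fract p' / to_fract q'" "p' \<in> supported E"
    "q' \<in> supported S" "coeff q' 0 \<noteq> 0" by (rule stalk_cuspE)
  have "q \<noteq> 0" "q' \<noteq> 0" using 1 2 by auto
  then have "f + g = to_fract (p * q' + p' * q) / to_fract (q * q')"
    unfolding 1 2 by (rule fract_add)
  also have "\<dots> \<in> stalk_cusp S E"
  proof (rule stalk_cuspI)
    show "p * q' + p' * q \<in> supported E"
      using 1 2 assms(3)
      by (intro supported_add; subst mult.commute) (auto intro!: supported_mult[of _ S _ E])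
    show "q * q' \<in> supported S" using 1 2 assms(4) by (auto intro!: supported_mult[of _ S _ S])
    show "coeff (q * q') 0 \<noteq> 0" using 1 2 by (simp add: coeff_mult)
  qed
  finally show ?thesis .
qed

lemma stalk_cusp_mult:
  assumes "f \<in> stalk_cusp S A" "g \<in> stalk_cusp S B"
    and "\<And>i j. i \<in> A \<Longrightarrow> j \<in> B \<Longrightarrow> i + j \<in> E" "\<And>s e. s \<in> S \<Longrightarrow> e \<in> S \<Longrightarrow> s + e \<in> S"
  shows "f * g \<in> stalk_cusp S E"
proof -
  from assms(1) obtain p q where 1: "f = to_fract p / to_fract q" "p \<in> supported A"
    "q \<in> supported S" "coeff q 0 \<noteq> 0" by (rule stalk_cuspE)
  from assms(2) obtain p' q' where 2: "g = to_fract p' / to_fract q'" "p' \<in> supported B"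
    "q' \<in> supported S" "coeff q' 0 \<noteq> 0" by (rule stalk_cuspE)
  have "f * g = to_fract (p * p') / to_fract (q * q')"
    by (simp only: 1 2 fract_mult)
  also have "\<dots> \<in> stalk_cusp S E"
  proof (rule stalk_cuspI)
    show "p * p' \<in> supported E"
      using 1 2 assms(3) by (auto intro!: supported_mult[of _ A _ B])
    show "q * q' \<in> supported S" using 1 2 assms(4) by (auto intro!: supported_mult[of _ S _ S])
    show "coeff (q * q') 0 \<noteq> 0" using 1 2 by (simp add: coeff_mult)
  qed
  finally show ?thesis .
qed

lemma stalk_cusp_mono: "E \<subseteq> E' \<Longrightarrow> stalk_cusp S E \<subseteq> stalk_cusp S E'"
  unfolding stalk_cusp_def by (blast intro: supported_mono)

lemma stalk_affine_add: "f \<in> stalk_affine c \<Longrightarrow> g \<in> stalk_affine c \<Longrightarrow> f + g \<in> stalk_affine c"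
proof (elim stalk_affineE)
  fix p q p' q' :: "'a poly"
  assume h: "f = to_fract p / to_fract q" "poly q c \<noteq> 0" "g = to_fract p' / to_fract q'" "poly q' c \<noteq> 0"
  then have "f + g = to_fract (p * q' + p' * q) / to_fract (q * q')"
    by (subst fract_add[symmetric]) auto
  also have "\<dots> \<in> stalk_affine c" by (rule stalk_affineI) (use h in simp)
  finally show ?thesis .
qed

lemma stalk_affine_mult: "f \<in> stalk_affine c \<Longrightarrow> g \<in> stalk_affine c \<Longrightarrow> f * g \<in> stalk_affine c"
proof (elim stalk_affineE)
  fix p q p' q' :: "'a poly"
  assume h: "f = to_fract p / to_fract q" "poly q c \<noteq> 0" "g = to_fract p' / to_fract q'" "poly q' c \<noteq> 0"
  then have "f * g = to_fract (p * p') / to_fract (q * q')" by simp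
  also have "\<dots> \<in> stalk_affine c" by (rule stalk_affineI) (use h in simp)
  finally show ?thesis .
qed

lemma to_fract_in_stalk_affine [simp]: "to_fract p \<in> stalk_affine c"
  using stalk_affineI[of 1 c p] by simp

lemma stalk_affine_0 [simp]: "0 \<in> stalk_affine c"
  using to_fract_in_stalk_affine[of 0] by simp

lemma stalk_affine_uminus: "f \<in> stalk_affine c \<Longrightarrow> - f \<in> stalk_affine c"
  using stalk_affine_mult[of "to_fract (-1)" c f] by (simp del: to_fract_uminus) simp

lemma stalk_affine_sum: "(\<And>i. i \<in> I \<Longrightarrow> f i \<in> stalk_affine c) \<Longrightarrow> sum f I \<in> stalk_affine c"
  by (induction I rule: infinite_finite_induct) (auto intro: stalk_affine_add)

lemma stalk_infinity_add:
  "f \<in> stalk_infinity b \<Longrightarrow> g \<in> stalk_infinity b \<Longrightarrow> f + g \<in> stalk_infinity b"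
proof (elim stalk_infinityE)
  fix p q p' q' :: "'a poly"
  assume h: "f = to_fract p / to_fract q" "q \<noteq> 0" "degree p \<le> degree q + b"
    "g = to_fract p' / to_fract q'" "q' \<noteq> 0" "degree p' \<le> degree q' + b"
  then have "f + g = to_fract (p * q' + p' * q) / to_fract (q * q')"
    by (subst fract_add[symmetric]) auto
  also have "\<dots> \<in> stalk_infinity b"
  proof (rule stalk_infinityI)
    have "degree (p * q') \<le> degree q + degree q' + b"
      using degree_mult_le[of p q'] h by simp
    moreover have "degree (p' * q) \<le> degree q + degree q' + b"
      using degree_mult_le[of p' q] h by simp
    ultimately show "degree (p * q' + p' * q) \<le> degree (q * q') + b"
      using h by (simp add: degree_mult_eq degree_add_le)
  qed (use h in simp)
  finally show ?thesis .
qed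

lemma stalk_infinity_mult:
  "f \<in> stalk_infinity b \<Longrightarrow> g \<in> stalk_infinity b' \<Longrightarrow> f * g \<in> stalk_infinity (b + b')"
proof (elim stalk_infinityE)
  fix p q p' q' :: "'a poly"
  assume h: "f = to_fract p / to_fract q" "q \<noteq> 0" "degree p \<le> degree q + b"
    "g = to_fract p' / to_fract q'" "q' \<noteq> 0" "degree p' \<le> degree q' + b'"
  then have "f * g = to_fract (p * p') / to_fract (q * q')" by simp
  also have "\<dots> \<in> stalk_infinity (b + b')"
    using degree_mult_le[of p p'] h by (intro stalk_infinityI) (simp_all add: degree_mult_eq)
  finally show ?thesis .
qed

lemma stalk_infinity_mono: "b \<le> b' \<Longrightarrow> stalk_infinity b \<subseteq> stalk_infinity b'"
  unfolding stalk_infinity_def by force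

lemma to_fract_in_stalk_infinity_iff:
  "to_fract p \<in> stalk_infinity b \<longleftrightarrow> degree p \<le> b"
proof
  assume "to_fract p \<in> stalk_infinity b"
  then obtain p' q' where h: "to_fract p = to_fract p' / to_fract q'" "q' \<noteq> 0"
    "degree p' \<le> degree q' + b" by (rule stalk_infinityE)
  then have "p * q' = p'" using fract_eq_iff[of 1 q' p p'] by simp
  then show "degree p \<le> b" using h by (cases "p = 0") (auto simp: degree_mult_eq)
next
  assume "degree p \<le> b"
  then show "to_fract p \<in> stalk_infinity b" using stalk_infinityI[of 1 p b] by simp
qed

lemma stalk_infinity_0 [simp]: "0 \<in> stalk_infinity b"
  using to_fract_in_stalk_infinity_iff[of 0 b] by simp

section \<open>Local rings of a monomial curve\<close>

text \<open>The form of degree \<open>d\<close>, dehomogenized and pulled back to the parameter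
  t.\<close>

definition form_poly ::
  "nat \<Rightarrow> (nat \<Rightarrow> nat) \<Rightarrow> nat \<Rightarrow> ((nat \<Rightarrow> nat) \<Rightarrow> 'a::field) \<Rightarrow> 'a poly" where
  "form_poly m \<nu> d F = (\<Sum>\<alpha>\<in>multi_indices m d. monom (F \<alpha>) (\<Sum>i\<le>m. \<alpha> i * \<nu> i))"

definition affine_point :: "nat \<Rightarrow> (nat \<Rightarrow> nat) \<Rightarrow> 'a::field \<Rightarrow> 'a ppoint" where
  "affine_point m \<nu> c = proj (\<lambda>i. if i \<le> m then c ^ \<nu> i else 0)"

definition infinity_point :: "nat \<Rightarrow> 'a::field ppoint" where
  "infinity_point m = proj (\<lambda>i. if i = m then 1 else 0)"

lemma generic_eval_eq: "generic_eval m \<nu> d F = to_fract (form_poly m \<nu> d F)"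
proof -
  have *: "const c * (\<Prod>i\<le>m. (tt ^ \<nu> i) ^ \<alpha> i) = to_fract (monom c (\<Sum>i\<le>m. \<alpha> i * \<nu> i))"
    for c :: 'a and \<alpha> :: "nat \<Rightarrow> nat"
  proof -
    have "(\<Prod>i\<le>m. (tt ^ \<nu> i) ^ \<alpha> i) = (tt :: 'a ratfun) ^ (\<Sum>i\<le>m. \<alpha> i * \<nu> i)"
      by (simp add: power_sum power_mult[symmetric] mult.commute)
    then show ?thesis using smul_tt_power[of c] by (simp only: smul_def)
  qed
  show ?thesis
    by (simp add: generic_eval_def form_eval_def form_poly_def *)
qed

text \<open>Homogeneity makes non-vanishing at a point independent of the coordinate vector, so the
  condition over all representatives in \<open>local_ring\<close> can be tested on one of
  them.\<close>

lemma form_eval_scale: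
  "form_eval m d c (\<lambda>i. k * x i) = k ^ d * form_eval m d c x"
proof -
  have "c \<alpha> * (\<Prod>i\<le>m. (k * x i) ^ \<alpha> i) = k ^ d * (c \<alpha> * (\<Prod>i\<le>m. x i ^ \<alpha> i))"
    if "\<alpha> \<in> multi_indices m d" for \<alpha>
  proof -
    have "(\<Prod>i\<le>m. (k * x i) ^ \<alpha> i) = k ^ (\<Sum>i\<le>m. \<alpha> i) * (\<Prod>i\<le>m. x i ^ \<alpha> i)"
      by (simp add: power_mult_distrib prod.distrib power_sum)
    also have "(\<Sum>i\<le>m. \<alpha> i) = d" using that by (simp add: multi_indices_def)
    finally show ?thesis by (simp add: algebra_simps)
  qed
  then show ?thesis by (simp add: form_eval_def sum_distrib_left cong: sum.cong)
qed

lemma form_eval_nonzero_proj: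
  "(\<forall>x\<in>proj y. form_eval m d G x \<noteq> 0) \<longleftrightarrow> form_eval m d G y \<noteq> (0 :: 'a::field)"
proof -
  have "form_eval m d G (\<lambda>i. k * y i) \<noteq> 0 \<longleftrightarrow> form_eval m d G y \<noteq> 0" if "k \<noteq> 0" for k
    using that by (simp add: form_eval_scale)
  moreover have "\<exists>k::'a. k \<noteq> 0" by (rule exI[of _ 1]) simp
  ultimately show ?thesis by (auto simp: proj_def)
qed

lemma form_eval_affine:
  "form_eval m d G (\<lambda>i. if i \<le> m then c ^ \<nu> i else 0) = poly (form_poly m \<nu> d G) c"
proof -
  have "(\<Prod>i\<le>m. (c ^ \<nu> i) ^ \<alpha> i) = c ^ (\<Sum>i\<le>m. \<alpha> i * \<nu> i)" for \<alpha> :: "nat \<Rightarrow> nat"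
    by (simp add: power_sum power_mult[symmetric] mult.commute)
  then show ?thesis
    by (simp add: form_eval_def form_poly_def poly_sum poly_monom)
qed

lemma self_in_proj: "x \<in> proj x"
  unfolding proj_def by (intro CollectI exI[of _ 1]) simp

lemma proj_scale:
  assumes "k \<noteq> 0"
  shows "proj (\<lambda>i. k * x i) = proj x"
proof
  show "proj (\<lambda>i. k * x i) \<subseteq> proj x"
    unfolding proj_def using assms by (force simp: mult.assoc[symmetric])
  show "proj x \<subseteq> proj (\<lambda>i. k * x i)"
  proof
    fix y assume "y \<in> proj x"
    then obtain c where "c \<noteq> 0" "y = (\<lambda>i. c * x i)" by (auto simp: proj_def)
    then show "y \<in> proj (\<lambda>i. k * x i)"
      unfolding proj_def using assms by (intro CollectI exI[of _ "c / k"]) auto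
  qed
qed

lemma sum_induct_in:
  fixes f :: "'i \<Rightarrow> 'b::comm_monoid_add"
  assumes "0 \<in> X" "\<And>x y. x \<in> X \<Longrightarrow> y \<in> X \<Longrightarrow> x + y \<in> X" "\<And>i. i \<in> I \<Longrightarrow> f i \<in> X"
  shows "sum f I \<in> X"
  using assms(3) by (induction I rule: infinite_finite_induct) (auto intro: assms(1,2))

section \<open>Exponents of forms and the numerical semigroup they generate\<close>

locale exponent_sequence =
  fixes m :: nat and \<nu> :: "nat \<Rightarrow> nat"
  assumes m_pos: "m \<ge> 1" and nu_0: "\<nu> 0 = 0" and nu_mono: "strict_mono_on {..m} \<nu>"
begin

lemma nu_less: "i < j \<Longrightarrow> j \<le> m \<Longrightarrow> \<nu> i < \<nu> j"
  using nu_mono by (auto simp: strict_mono_on_def)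

lemma nu_le: "i \<le> m \<Longrightarrow> \<nu> i \<le> \<nu> m"
  using nu_less[of i m] by (cases "i = m") auto

lemma nu_pos: "0 < i \<Longrightarrow> i \<le> m \<Longrightarrow> 0 < \<nu> i"
  using nu_less[of 0 i] by (simp add: nu_0)

text \<open>The exponents of t that occur in forms of degree \<open>d\<close>. Here the
  multi-indices are arbitrary off {..m}, so that they can be added pointwise;
  \<open>wsums_eq\<close> reconciles this with \<open>multi_indices\<close>. Since
  \<open>\<nu> 0 = 0\<close>, a sum can be padded to any larger degree.\<close>

definition wsums :: "nat \<Rightarrow> nat set" where
  "wsums d = {\<Sum>i\<le>m. \<alpha> i * \<nu> i | \<alpha>. (\<Sum>i\<le>m. \<alpha> i) = d}"

definition sgp :: "nat set" where
  "sgp = (\<Union>d. wsums d)"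

lemma wsums_eq: "wsums d = (\<lambda>\<alpha>. \<Sum>i\<le>m. \<alpha> i * \<nu> i) ` multi_indices m d"
proof
  show "wsums d \<subseteq> (\<lambda>\<alpha>. \<Sum>i\<le>m. \<alpha> i * \<nu> i) ` multi_indices m d"
  proof
    fix x assume "x \<in> wsums d"
    then obtain \<alpha> where \<alpha>: "x = (\<Sum>i\<le>m. \<alpha> i * \<nu> i)" "(\<Sum>i\<le>m. \<alpha> i) = d"
      by (auto simp: wsums_def)
    define \<beta> where "\<beta> = restrict \<alpha> {..m}"
    have "\<alpha> i \<le> d" if "i \<le> m" for i
      using \<alpha>(2) member_le_sum[of i "{..m}" \<alpha>] that by simp
    then have "\<beta> \<in> multi_indices m d" using \<alpha>(2) by (auto simp: \<beta>_def multi_indices_def)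
    moreover have "x = (\<Sum>i\<le>m. \<beta> i * \<nu> i)" by (simp add: \<alpha>(1) \<beta>_def)
    ultimately show "x \<in> (\<lambda>\<alpha>. \<Sum>i\<le>m. \<alpha> i * \<nu> i) ` multi_indices m d" by blast
  qed
qed (auto simp: wsums_def multi_indices_def)

lemma wsums_add: "x \<in> wsums d \<Longrightarrow> y \<in> wsums e \<Longrightarrow> x + y \<in> wsums (d + e)"
proof -
  assume "x \<in> wsums d" "y \<in> wsums e"
  then obtain \<alpha> \<beta> where "x = (\<Sum>i\<le>m. \<alpha> i * \<nu> i)" "(\<Sum>i\<le>m. \<alpha> i) = d"
    "y = (\<Sum>i\<le>m. \<beta> i * \<nu> i)" "(\<Sum>i\<le>m. \<beta> i) = e" by (auto simp: wsums_def)
  then show ?thesis unfolding wsums_def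
    by (intro CollectI exI[of _ "\<lambda>i. \<alpha> i + \<beta> i"]) (simp add: sum.distrib algebra_simps)
qed

lemma nu_in_wsums: "i \<le> m \<Longrightarrow> k * \<nu> i \<in> wsums k"
proof -
  assume i: "i \<le> m"
  have "(\<Sum>j\<le>m. (if j = i then k else 0) * \<nu> j) = (\<Sum>j\<le>m. if j = i then k * \<nu> j else 0)"
    by (intro sum.cong) auto
  with i show ?thesis unfolding wsums_def
    by (intro CollectI exI[of _ "\<lambda>j. if j = i then k else 0"]) simp
qed

lemma zero_in_wsums: "0 \<in> wsums d"
  using nu_in_wsums[of 0 d] by (simp add: nu_0)

lemma wsums_mono: "d \<le> e \<Longrightarrow> wsums d \<subseteq> wsums e"
  using wsums_add[of _ d 0 "e - d"] zero_in_wsums[of "e - d"] by auto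

lemma wsums_le: "x \<in> wsums d \<Longrightarrow> x \<le> d * \<nu> m"
  by (auto simp: wsums_def sum_distrib_right intro!: sum_mono mult_left_mono nu_le)

lemma sgp_add: "x \<in> sgp \<Longrightarrow> y \<in> sgp \<Longrightarrow> x + y \<in> sgp"
  unfolding sgp_def using wsums_add by blast

lemma zero_in_sgp: "0 \<in> sgp"
  unfolding sgp_def using zero_in_wsums by blast

lemma nu_in_sgp: "i \<le> m \<Longrightarrow> k * \<nu> i \<in> sgp"
  unfolding sgp_def using nu_in_wsums by blast

text \<open>\<open>form_poly\<close> is linear in the coefficients, so it suffices to reach
  monomials. Several multi-indices may have the same weight; one of them is chosen and given the
  whole coefficient. From here on forms can be replaced by polynomials with restricted
  support.\<close>

lemma range_form_poly: "range (form_poly m \<nu> d) = (supported (wsums d) :: 'a::field poly set)"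
proof
  show "range (form_poly m \<nu> d) \<subseteq> (supported (wsums d) :: 'a poly set)"
  proof safe
    fix F :: "(nat \<Rightarrow> nat) \<Rightarrow> 'a"
    show "form_poly m \<nu> d F \<in> supported (wsums d)"
      unfolding form_poly_def
      by (rule sum_induct_in) (auto simp: wsums_eq intro: supported_add supported_monom)
  qed
next
  have finM: "finite (multi_indices m d)"
    by (rule finite_subset[of _ "{..m} \<rightarrow>\<^sub>E {..d}"]) (auto simp: multi_indices_def intro!: finite_PiE)
  have add: "form_poly m \<nu> d F + form_poly m \<nu> d F' = form_poly m \<nu> d (\<lambda>\<alpha>. F \<alpha> + F' \<alpha>)"
    for F F' :: "(nat \<Rightarrow> nat) \<Rightarrow> 'a"
    by (simp add: form_poly_def sum.distrib add_monom[symmetric])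
  have zero: "form_poly m \<nu> d (\<lambda>\<alpha>. 0 :: 'a) = 0" by (simp add: form_poly_def)
  have mon: "monom c i \<in> range (form_poly m \<nu> d)" if i: "c \<noteq> 0 \<longrightarrow> i \<in> wsums d" for c :: 'a and i
  proof (cases "c = 0")
    case True
    then show ?thesis using zero by (metis monom_eq_0 rangeI)
  next
    case False
    then obtain \<beta> where \<beta>: "\<beta> \<in> multi_indices m d" "i = (\<Sum>j\<le>m. \<beta> j * \<nu> j)"
      using i by (auto simp: wsums_eq)
    have "form_poly m \<nu> d (\<lambda>\<alpha>. if \<alpha> = \<beta> then c else 0) =
        (\<Sum>\<alpha>\<in>multi_indices m d. if \<alpha> = \<beta> then monom c i else 0)"
      unfolding form_poly_def by (rule sum.cong) (auto simp: \<beta>)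
    also have "\<dots> = monom c i" using \<beta> finM by (simp add: sum.delta)
    finally show ?thesis by (metis rangeI)
  qed
  show "supported (wsums d) \<subseteq> range (form_poly m \<nu> d :: _ \<Rightarrow> 'a poly)"
  proof
    fix p :: "'a poly" assume p: "p \<in> supported (wsums d)"
    have "(\<Sum>i\<le>degree p. monom (coeff p i) i) \<in> range (form_poly m \<nu> d)"
    proof (rule sum_induct_in)
      show "0 \<in> range (form_poly m \<nu> d :: _ \<Rightarrow> 'a poly)" using zero by (metis rangeI)
      show "x + y \<in> range (form_poly m \<nu> d)"
        if "x \<in> range (form_poly m \<nu> d)" "y \<in> range (form_poly m \<nu> d)" for x y :: "'a poly"
        using that add by auto
      show "monom (coeff p i) i \<in> range (form_poly m \<nu> d)" for i
        using p by (intro mon) (auto simp: supported_def)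
    qed
    then show "p \<in> range (form_poly m \<nu> d)" by (simp add: poly_as_sum_of_monoms)
  qed
qed

text \<open>Since \<open>\<nu> i < \<nu> m\<close> for i < m, the weight of a multi-index of degree
  \<open>d\<close> reaches d * \<open>\<nu> m\<close> only if it is concentrated at index m. That is
  also the only monomial that survives at the point at infinity.\<close>

lemma form_eval_infinity:
  "form_eval m d G (\<lambda>i. if i = m then 1 else 0 :: 'a::field) = coeff (form_poly m \<nu> d G) (d * \<nu> m)"
proof -
  have "(\<Prod>i\<le>m. (if i = m then 1 else 0 :: 'a) ^ \<alpha> i) =
      (if (\<Sum>i\<le>m. \<alpha> i * \<nu> i) = d * \<nu> m then 1 else 0)"
    if "\<alpha> \<in> multi_indices m d" for \<alpha>
  proof -
    have d: "d = (\<Sum>i\<le>m. \<alpha> i)" using that by (simp add: multi_indices_def)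
    show ?thesis
    proof (cases "\<forall>i<m. \<alpha> i = 0")
      case True
      then have "(\<Sum>i\<le>m. \<alpha> i * \<nu> i) = \<alpha> m * \<nu> m" "(\<Sum>i\<le>m. \<alpha> i) = \<alpha> m"
        by (simp_all flip: lessThan_Suc_atMost)
      then show ?thesis using True d by (simp flip: lessThan_Suc_atMost)
    next
      case False
      then obtain i where i: "i < m" "\<alpha> i \<noteq> 0" by auto
      have "(\<Sum>i\<le>m. \<alpha> i * \<nu> i) < (\<Sum>i\<le>m. \<alpha> i * \<nu> m)"
        using i nu_less[of i m] nu_le
        by (intro sum_strict_mono_ex1) auto
      then have "(\<Sum>i\<le>m. \<alpha> i * \<nu> i) \<noteq> d * \<nu> m" by (simp add: d sum_distrib_right)
      moreover have "(\<Prod>i\<le>m. (if i = m then 1 else 0 :: 'a) ^ \<alpha> i) = 0"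
        using i by (intro prod_zero) auto
      ultimately show ?thesis by simp
    qed
  qed
  then have "form_eval m d G (\<lambda>i. if i = m then 1 else 0 :: 'a) =
      (\<Sum>\<alpha>\<in>multi_indices m d. G \<alpha> * (if (\<Sum>i\<le>m. \<alpha> i * \<nu> i) = d * \<nu> m then 1 else 0))"
    unfolding form_eval_def by (intro sum.cong) auto
  also have "\<dots> = coeff (form_poly m \<nu> d G) (d * \<nu> m)"
    unfolding form_poly_def coeff_sum by (intro sum.cong) auto
  finally show ?thesis .
qed

lemma local_ring_affine:
  "local_ring m \<nu> (affine_point m \<nu> c) =
     {to_fract p / to_fract q | d p q.
        p \<in> supported (wsums d) \<and> q \<in> supported (wsums d) \<and> poly q (c :: 'a::field) \<noteq> 0}"
  unfolding local_ring_def affine_point_def form_eval_nonzero_proj form_eval_affine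
    generic_eval_eq range_form_poly[symmetric] by blast

lemma local_ring_infinity:
  "local_ring m \<nu> (infinity_point m :: 'a::field ppoint) =
     {to_fract p / to_fract q | d p q.
        p \<in> supported (wsums d) \<and> q \<in> supported (wsums d) \<and> coeff q (d * \<nu> m) \<noteq> 0}"
  unfolding local_ring_def infinity_point_def form_eval_nonzero_proj form_eval_infinity
    generic_eval_eq range_form_poly[symmetric] by blast

lemma function_field_eq:
  "function_field m \<nu> =
     {to_fract p / to_fract q | d p q.
        p \<in> supported (wsums d) \<and> q \<in> supported (wsums d) \<and> q \<noteq> (0 :: 'a::field poly)}"
  unfolding function_field_def generic_eval_eq range_form_poly[symmetric] to_fract_eq_0_iff by blast

lemma pointP_eq: "(pointP :: 'a::field ppoint) = affine_point m \<nu> 0"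
proof -
  have "(\<lambda>i. if i = 0 then 1 else 0) = (\<lambda>i. if i \<le> m then (0 :: 'a) ^ \<nu> i else 0)"
    using nu_pos nu_0 by (auto simp: fun_eq_iff zero_power)
  then show ?thesis by (simp add: pointP_def affine_point_def)
qed

text \<open>The forms in a quotient must share one degree, whereas the right-hand side mentions
  none. A polynomial has finitely many exponents and \<open>wsums\<close> increases with the degree,
  so numerator and denominator fit into a common \<open>wsums d\<close>.\<close>

lemma local_ring_cusp: "local_ring m \<nu> (pointP :: 'a::field ppoint) = stalk_cusp sgp sgp"
proof
  show "local_ring m \<nu> (pointP :: 'a ppoint) \<subseteq> stalk_cusp sgp sgp"
    unfolding pointP_eq local_ring_affine
    by (auto simp: sgp_def poly_0_coeff_0 intro!: stalk_cuspI elim!: supported_mono)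
next
  have fin: "\<exists>d. p \<in> supported (wsums d)" if p: "p \<in> supported sgp" for p :: "'a poly"
  proof -
    have "\<forall>i. coeff p i \<noteq> 0 \<longrightarrow> (\<exists>d. i \<in> wsums d)" using p by (auto simp: supported_def sgp_def)
    then obtain D where D: "coeff p i \<noteq> 0 \<Longrightarrow> i \<in> wsums (D i)" for i by metis
    define d where "d = (\<Sum>i\<le>degree p. D i)"
    have "coeff p i \<noteq> 0 \<Longrightarrow> i \<in> wsums d" for i
      using D[of i] wsums_mono[of "D i" d] le_degree[of p i] member_le_sum[of i "{..degree p}" D]
      by (auto simp: d_def)
    then show ?thesis by (auto simp: supported_def)
  qed
  show "stalk_cusp sgp sgp \<subseteq> local_ring m \<nu> (pointP :: 'a ppoint)"
  proof
    fix f :: "'a ratfun" assume "f \<in> stalk_cusp sgp sgp"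
    then obtain p q where pq: "f = to_fract p / to_fract q" "p \<in> supported sgp" "q \<in> supported sgp"
      "coeff q 0 \<noteq> 0" by (rule stalk_cuspE)
    obtain d where "p \<in> supported (wsums d)" using fin pq by blast
    moreover obtain e where "q \<in> supported (wsums e)" using fin pq by blast
    ultimately have "p \<in> supported (wsums (max d e))" "q \<in> supported (wsums (max d e))"
      using wsums_mono[of d "max d e"] wsums_mono[of e "max d e"] by (auto elim: supported_mono)
    with pq show "f \<in> local_ring m \<nu> pointP"
      unfolding pointP_eq local_ring_affine by (auto simp: poly_0_coeff_0)
  qed
qed

text \<open>The denominator is a unit at t = 0, so the valuation is the order of the numerator at 0.
  That order is itself an exponent with nonzero coefficient and hence lies in \<open>sgp\<close>.
  Conversely t^j realizes every j in \<open>sgp\<close>.\<close>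

lemma semigroup_of_eq: "semigroup_of TYPE('a::field) m \<nu> = sgp"
proof (rule set_eqI)
  fix j
  have "j \<in> sgp" if h: "f \<in> stalk_cusp sgp sgp" "f \<noteq> 0" "val0 f = int j" for f :: "'a ratfun"
  proof -
    obtain p q where pq: "f = to_fract p / to_fract q" "p \<in> supported sgp" "q \<in> supported sgp"
      "coeff q 0 \<noteq> 0" using h(1) by (rule stalk_cuspE)
    have "p \<noteq> 0" using pq h by auto
    then obtain r where r: "p = [:- 0, 1:] ^ order 0 p * r" "\<not> [:- 0, 1:] dvd r"
      using order_decomp[of p 0] by blast
    define n where "n = order 0 p"
    have p: "p = monom 1 n * r" using r(1) by (simp add: n_def monom_altdef)
    have r0: "poly r 0 \<noteq> 0" using r(2) by (simp add: poly_eq_0_iff_dvd)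
    have "f = tt powi int n * (to_fract r / to_fract q)" by (simp add: pq(1) p tt_power)
    then have "val0 f = int n" using val0_monomial_mult[of r q "int n"] r0 pq(4)
      by (simp only: poly_0_coeff_0 simp_thms)
    then have "j = n" using h(3) by simp
    moreover have "coeff p n \<noteq> 0" using r0 by (simp add: p coeff_monom_mult poly_0_coeff_0)
    ultimately show ?thesis using pq(2) by (auto simp: supported_def)
  qed
  moreover have "\<exists>f\<in>(stalk_cusp sgp sgp :: 'a ratfun set). f \<noteq> 0 \<and> val0 f = int j" if "j \<in> sgp"
  proof (rule bexI[of _ "tt ^ j :: 'a ratfun"])
    show "(tt ^ j :: 'a ratfun) \<in> stalk_cusp sgp sgp"
      using stalk_cuspI[of "monom 1 j :: 'a poly" sgp 1 sgp] that
      by (simp add: tt_power supported_monom supported_1 zero_in_sgp)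
    show "(tt ^ j :: 'a ratfun) \<noteq> 0 \<and> val0 (tt ^ j :: 'a ratfun) = int j"
      using val0_monomial_mult[of "1 :: 'a poly" 1 "int j"] by simp
  qed
  ultimately show "j \<in> semigroup_of TYPE('a) m \<nu> \<longleftrightarrow> j \<in> sgp"
    unfolding semigroup_of_def local_ring_cusp by blast
qed

section \<open>The points of the curve\<close>

lemma curve_eq: "curve m \<nu> = insert (infinity_point m) (range (affine_point m \<nu> :: 'a::field \<Rightarrow> _))"
proof -
  have param_inf: "param m \<nu> x = infinity_point m" if "x 0 = 0" "x 1 \<noteq> 0" for x :: "nat \<Rightarrow> 'a"
  proof -
    have "(\<lambda>i. if i \<le> m then x 0 ^ (\<nu> m - \<nu> i) * x 1 ^ \<nu> i else 0) =
        (\<lambda>i. x 1 ^ \<nu> m * (if i = m then 1 else 0))"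
    proof
      fix i show "(if i \<le> m then x 0 ^ (\<nu> m - \<nu> i) * x 1 ^ \<nu> i else 0) =
          x 1 ^ \<nu> m * (if i = m then 1 else 0)"
        using that nu_less[of i m] by (cases i m rule: linorder_cases) (simp_all add: zero_power)
    qed
    then show ?thesis using that by (simp add: param_def infinity_point_def proj_scale)
  qed
  have param_aff: "param m \<nu> x = affine_point m \<nu> (x 1 / x 0)" if "x 0 \<noteq> 0" for x :: "nat \<Rightarrow> 'a"
  proof -
    have "(\<lambda>i. if i \<le> m then x 0 ^ (\<nu> m - \<nu> i) * x 1 ^ \<nu> i else 0) =
        (\<lambda>i. x 0 ^ \<nu> m * (if i \<le> m then (x 1 / x 0) ^ \<nu> i else 0))"
    proof
      fix i show "(if i \<le> m then x 0 ^ (\<nu> m - \<nu> i) * x 1 ^ \<nu> i else 0) =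
          x 0 ^ \<nu> m * (if i \<le> m then (x 1 / x 0) ^ \<nu> i else 0)"
        using that nu_le[of i] by (simp add: power_diff power_divide)
    qed
    moreover have "proj (\<lambda>i. x 0 ^ \<nu> m * (if i \<le> m then (x 1 / x 0) ^ \<nu> i else 0)) =
        proj (\<lambda>i. if i \<le> m then (x 1 / x 0) ^ \<nu> i else 0)"
      by (rule proj_scale) (use that in simp)
    ultimately show ?thesis unfolding param_def affine_point_def by (simp only:)
  qed
  show ?thesis
  proof
    show "curve m \<nu> \<subseteq> insert (infinity_point m) (range (affine_point m \<nu> :: 'a \<Rightarrow> _))"
    proof
      fix R :: "'a ppoint" assume "R \<in> curve m \<nu>"
      then obtain x where x: "x \<in> hvec 1" "R = param m \<nu> x" unfolding curve_def by blast
      show "R \<in> insert (infinity_point m) (range (affine_point m \<nu>))"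
      proof (cases "x 0 = 0")
        case True
        obtain i where i: "x i \<noteq> 0" "\<forall>i>1. x i = 0" using x(1) by (auto simp: hvec_def)
        then have "\<not> i > 1" by blast
        then have "i = 0 \<or> i = 1" by linarith
        with True i have "x 1 \<noteq> 0" by metis
        with True x param_inf show ?thesis by blast
      next
        case False
        with x param_aff show ?thesis by blast
      qed
    qed
    show "insert (infinity_point m) (range (affine_point m \<nu> :: 'a \<Rightarrow> _)) \<subseteq> curve m \<nu>"
    proof -
      define x where "x c i = (if i = 0 then c else if i = 1 then 1 else 0)" for c :: 'a and i :: nat
      define y where "y c i = (if i = 0 then 1 else if i = 1 then c else 0)" for c :: 'a and i :: nat
      have "x 0 \<in> hvec 1" unfolding hvec_def by (auto simp: x_def intro!: exI[of _ 1])
      moreover have "param m \<nu> (x 0) = infinity_point m" by (rule param_inf) (simp_all add: x_def)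
      ultimately have "infinity_point m \<in> (curve m \<nu> :: 'a ppoint set)"
        unfolding curve_def by (metis imageI)
      moreover have "affine_point m \<nu> c \<in> curve m \<nu>" for c :: 'a
      proof -
        have "y c \<in> hvec 1" unfolding hvec_def by (auto simp: y_def intro!: exI[of _ 0])
        moreover have "param m \<nu> (y c) = affine_point m \<nu> c"
          using param_aff[of "y c"] by (simp add: y_def)
        ultimately show ?thesis unfolding curve_def by (metis imageI)
      qed
      ultimately show ?thesis by blast
    qed
  qed
qed

lemma affine_neq_infinity: "affine_point m \<nu> c \<noteq> (infinity_point m :: 'a::field ppoint)"
proof
  assume *: "affine_point m \<nu> c = (infinity_point m :: 'a ppoint)"
  have "(\<lambda>i. if i \<le> m then c ^ \<nu> i else 0) \<in> infinity_point m"
    using self_in_proj[of "\<lambda>i. if i \<le> m then c ^ \<nu> i else 0"]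
    by (simp add: *[symmetric] affine_point_def)
  then obtain k where "(\<lambda>i. if i \<le> m then c ^ \<nu> i else 0) = (\<lambda>i. k * (if i = m then 1 else 0))"
    unfolding infinity_point_def proj_def by blast
  from fun_cong[OF this, of 0] show False using m_pos by (simp add: nu_0)
qed

lemma affine_neq_cusp: "c \<noteq> 0 \<Longrightarrow> affine_point m \<nu> c \<noteq> (pointP :: 'a::field ppoint)"
proof
  assume c: "c \<noteq> 0" and *: "affine_point m \<nu> c = (pointP :: 'a ppoint)"
  have "(\<lambda>i. if i \<le> m then c ^ \<nu> i else 0) \<in> (pointP :: 'a ppoint)"
    using self_in_proj[of "\<lambda>i. if i \<le> m then c ^ \<nu> i else 0"]
    by (simp add: *[symmetric] affine_point_def)
  then obtain k where "(\<lambda>i. if i \<le> m then c ^ \<nu> i else 0) = (\<lambda>i. k * (if i = 0 then 1 else 0))"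
    unfolding pointP_def proj_def by blast
  from fun_cong[OF this, of m] show False using m_pos c by simp
qed

lemma infinity_neq_cusp: "infinity_point m \<noteq> (pointP :: 'a::field ppoint)"
  using affine_neq_infinity[of 0] pointP_eq by metis

lemma curve_cases:
  assumes "R \<in> curve m \<nu>"
  obtains "R = (pointP :: 'a::field ppoint)" | "R = infinity_point m"
    | c where "c \<noteq> 0" "R = affine_point m \<nu> c"
proof -
  from assms consider "R = infinity_point m" | c where "R = affine_point m \<nu> c"
    unfolding curve_eq by blast
  then show thesis
  proof cases
    case 1
    then show ?thesis by (rule that(2))
  next
    case (2 c)
    show ?thesis
    proof (cases "c = 0")
      case True
      with 2 have "R = pointP" by (simp only: pointP_eq)
      then show ?thesis by (rule that(1))
    next
      case False
      then show ?thesis using 2 by (rule that(3))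
    qed
  qed
qed

end

text \<open>The order of vanishing at infinity of a quotient of polynomials is the difference of the
  degrees. If the maximal ideal at infinity is generated by \<open>h\<close>, then the order \<open>e\<close> of \<open>h\<close> divides
  the order of every element of the local ring, in particular all \<open>\<nu> m - \<nu> i\<close>; as \<open>t\<close> lies in the
  function field, \<open>e = 1\<close>.\<close>

lemma (in exponent_sequence) regular_at_infinity:
  assumes ff: "function_field m \<nu> = (UNIV :: 'a::field ratfun set)"
    and reg: "regular_point m \<nu> (infinity_point m :: 'a ppoint)"
  shows "\<exists>i<m. Suc (\<nu> i) = \<nu> m"
proof -
  define R :: "'a ppoint" where "R = infinity_point m"
  \<comment> \<open>\<open>L\<close> remembers the common degree of the two forms. The nonzero top
    coefficient forces \<open>degree q = d * \<nu> m\<close>, so the order at infinity is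
    \<open>degree q - degree p\<close> without truncation.\<close>
  define L where "L d p q \<longleftrightarrow> p \<in> supported (wsums d) \<and> q \<in> supported (wsums d) \<and>
      coeff q (d * \<nu> m) \<noteq> 0" for d and p q :: "'a poly"
  have L_mem: "to_fract p / to_fract q \<in> local_ring m \<nu> R" if "L d p q" for d p q
    using that unfolding R_def local_ring_infinity L_def by blast
  have L_ex: "\<exists>d p q. f = to_fract p / to_fract q \<and> L d p q" if "f \<in> local_ring m \<nu> R" for f
    using that unfolding R_def local_ring_infinity L_def by blast
  have deg_le: "degree p \<le> d * \<nu> m" if "p \<in> supported (wsums d)" for p :: "'a poly" and d
    using that wsums_le by (intro degree_le) (auto simp: supported_def, meson not_le)
  have deg_q: "degree q = d * \<nu> m" "q \<noteq> 0" if "L d p q" for d p q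
    using that deg_le[of q d] le_degree[of q "d * \<nu> m"] by (auto simp: L_def)
  have deg_pq: "degree p \<le> degree q" if "L d p q" for d p q
    using that deg_le[of p d] deg_q[OF that] by (auto simp: L_def)
  have deg_in: "degree p \<in> wsums d" if "p \<in> supported (wsums d)" "p \<noteq> 0" for p :: "'a poly" and d
    using that by (auto simp: supported_def)
  have deg_mult: "degree p + degree q' = degree q + degree p'"
    if "p * q' = q * p'" "p \<noteq> 0" "q' \<noteq> 0" "q \<noteq> 0" "p' \<noteq> 0" for p q p' q' :: "'a poly"
    using arg_cong[OF that(1), of degree] by (simp only: degree_mult_eq[OF that(2,3)] degree_mult_eq[OF that(4,5)])
  \<comment> \<open>Such a quotient vanishes at infinity, and multiplying by an element of the local
    ring cannot lower its order to that of 1.\<close>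
  have max: "to_fract p / to_fract q \<in> max_ideal m \<nu> R"
    if pq: "L d p q" "p \<noteq> 0" "degree p < degree q" for d p q
  proof -
    have "to_fract p / to_fract q * g \<noteq> 1" if g: "g \<in> local_ring m \<nu> R" for g
    proof
      assume one: "to_fract p / to_fract q * g = 1"
      obtain d' p' q' where g': "g = to_fract p' / to_fract q'" "L d' p' q'" using L_ex[OF g] by blast
      have "p' \<noteq> 0" using one g' by auto
      have "to_fract (p * p') / to_fract (q * q') = to_fract 1 / to_fract 1"
        using one by (simp add: g')
      then have "p * p' = q * q'"
        using deg_q(2)[OF pq(1)] deg_q(2)[OF g'(2)] fract_eq_iff[of "q * q'" 1 "p * p'" 1] by auto
      then have "degree p + degree p' = degree q + degree q'"
        using deg_mult[of p p' q q'] pq(2) \<open>p' \<noteq> 0\<close> deg_q(2)[OF pq(1)] deg_q(2)[OF g'(2)] by blast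
      with pq(3) deg_pq[OF g'(2)] show False by simp
    qed
    then show ?thesis using L_mem[OF pq(1)] unfolding max_ideal_def by blast
  qed
  obtain h where h: "h \<in> local_ring m \<nu> R" "max_ideal m \<nu> R = (\<lambda>f. h * f) ` local_ring m \<nu> R"
    using reg by (auto simp: regular_point_def R_def)
  obtain dh ph qh where hh: "h = to_fract ph / to_fract qh" "L dh ph qh" using L_ex[OF h(1)] by blast
  have L_nu: "L 1 (monom 1 (\<nu> i)) (monom 1 (\<nu> m))" if "i \<le> m" for i
    using nu_in_wsums[of i 1] nu_in_wsums[of m 1] that by (simp add: L_def supported_monom)
  \<comment> \<open>The nonzero element 1 / t^(\<open>\<nu> m\<close>) of the maximal ideal rules
    out \<open>h = 0\<close>.\<close>
  have "to_fract (monom 1 (\<nu> 0)) / to_fract (monom 1 (\<nu> m)) \<in> max_ideal m \<nu> R"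
    using L_nu[of 0] nu_less[of 0 m] m_pos by (intro max) (auto simp: degree_monom_eq)
  then obtain g where "to_fract (monom 1 (\<nu> 0)) / to_fract (monom 1 (\<nu> m)) = h * g"
    unfolding h(2) by blast
  then have "h \<noteq> 0" by auto
  then have ph: "ph \<noteq> 0" using hh by auto
  have "L 0 1 1" using zero_in_wsums by (simp add: L_def supported_1)
  then have "1 \<in> local_ring m \<nu> R" using L_mem[of 0 1 1] by simp
  then have "h * 1 \<in> max_ideal m \<nu> R" unfolding h(2) by (rule imageI)
  then have nonunit: "h * g \<noteq> 1" if "g \<in> local_ring m \<nu> R" for g
    using that unfolding max_ideal_def by auto
  define e where "e = degree qh - degree ph"
  have "degree ph \<noteq> degree qh"
  proof
    assume "degree ph = degree qh"
    then have "coeff ph (dh * \<nu> m) \<noteq> 0" using deg_q[OF hh(2)] ph by (metis leading_coeff_0_iff)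
    then have "L dh qh ph" using hh(2) by (simp add: L_def)
    from nonunit[OF L_mem[OF this]] show False using ph deg_q(2)[OF hh(2)] by (simp add: hh(1))
  qed
  then have e: "e > 0" "degree qh = degree ph + e" using deg_pq[OF hh(2)] by (auto simp: e_def)
  \<comment> \<open>Induction on the order: an element of positive order lies in the maximal ideal,
    and dividing it by \<open>h\<close> leaves an element of the local ring whose order is smaller
    by \<open>e\<close>.\<close>
  have dvd: "e dvd degree q - degree p" if "L d p q" "p \<noteq> 0" for d p q
    using that
  proof (induction "degree q - degree p" arbitrary: d p q rule: less_induct)
    case less
    show ?case
    proof (cases "degree p = degree q")
      case False
      then have lt: "degree p < degree q" using deg_pq[OF less.prems(1)] by simp
      have "to_fract p / to_fract q \<in> max_ideal m \<nu> R" using max[OF less.prems lt] .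
      then obtain g where g: "to_fract p / to_fract q = h * g" "g \<in> local_ring m \<nu> R"
        unfolding h(2) by blast
      obtain d' p' q' where g': "g = to_fract p' / to_fract q'" "L d' p' q'"
        using L_ex[OF g(2)] by blast
      note nz = deg_q(2)[OF less.prems(1)] deg_q(2)[OF hh(2)] deg_q(2)[OF g'(2)]
      have "p' \<noteq> 0" using g(1) g' less.prems(2) nz by auto
      have "to_fract p / to_fract q = to_fract (ph * p') / to_fract (qh * q')"
        using g(1) by (simp add: hh(1) g'(1))
      then have "p * (qh * q') = q * (ph * p')"
        using nz fract_eq_iff[of q "qh * q'" p "ph * p'"] by (auto simp: mult.commute)
      then have "degree p + degree (qh * q') = degree q + degree (ph * p')"
        using nz ph \<open>p' \<noteq> 0\<close> less.prems(2) by (intro deg_mult) auto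
      then have deg: "degree p + (degree qh + degree q') = degree q + (degree ph + degree p')"
        using nz ph \<open>p' \<noteq> 0\<close> by (simp add: degree_mult_eq)
      then have eq: "degree q - degree p = e + (degree q' - degree p')"
        using e lt deg_pq[OF g'(2)] by simp
      then have "e dvd degree q' - degree p'"
        using less.hyps[of q' p' d'] g'(2) \<open>p' \<noteq> 0\<close> e by simp
      then show ?thesis unfolding eq by simp
    qed simp
  qed
  have dvd_diff: "e dvd \<nu> m - \<nu> i" if "i \<le> m" for i
    using dvd[OF L_nu[OF that]] by (simp add: degree_monom_eq)
  then have "e dvd \<nu> m" using dvd_diff[of 0] by (simp add: nu_0)
  then have "e dvd \<nu> i" if "i \<le> m" for i
    using dvd_diff[OF that] nu_le[OF that] by (meson dvd_diffD1)
  then have dvd_wsums: "e dvd x" if "x \<in> wsums d" for x d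
    using that by (auto simp: wsums_def intro!: dvd_sum)
  \<comment> \<open>All exponents of forms are multiples of \<open>e\<close>. Writing t = P / Q with
    forms P and Q gives two such multiples that differ by 1.\<close>
  have "tt \<in> (function_field m \<nu> :: 'a ratfun set)" using ff by simp
  then obtain d P Q where PQ: "tt = to_fract P / to_fract Q" "P \<in> supported (wsums d)"
      "Q \<in> supported (wsums d)" "(Q :: 'a poly) \<noteq> 0"
    unfolding function_field_eq by blast
  have "to_fract [:0, 1:] / to_fract 1 = to_fract P / to_fract Q" using PQ(1) by (simp add: tt_def)
  then have "[:0, 1:] * Q = P" using fract_eq_iff[of 1 Q "[:0, 1:]" P] PQ by simp
  then have "P \<noteq> 0" "degree P = Suc (degree Q)" using PQ(4) by auto
  then have "e dvd Suc (degree Q)" "e dvd degree Q"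
    using dvd_wsums deg_in[OF PQ(2)] deg_in[OF PQ(3)] PQ(4) by metis+
  then have "e = 1" by (metis dvd_add_right_iff nat_dvd_1_iff_1 Suc_eq_plus1)
  \<comment> \<open>With \<open>e = 1\<close> the degree of \<open>ph\<close> falls short of the
    maximum \<open>dh * \<nu> m\<close> by exactly 1. This deficit is a sum of terms \<alpha> i *
    (\<open>\<nu> m - \<nu> i\<close>) over naturals, so one term equals 1 and both of its factors
    are 1.\<close>
  have "degree ph \<in> wsums dh" using hh(2) ph deg_in by (auto simp: L_def)
  then obtain \<alpha> where \<alpha>: "degree ph = (\<Sum>i\<le>m. \<alpha> i * \<nu> i)" "(\<Sum>i\<le>m. \<alpha> i) = dh"
    by (auto simp: wsums_def)
  have "(\<Sum>i\<le>m. \<alpha> i * \<nu> m) = (\<Sum>i\<le>m. \<alpha> i * \<nu> i) + 1"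
    using e(2) \<open>e = 1\<close> deg_q(1)[OF hh(2)] \<alpha> by (simp flip: sum_distrib_right)
  also have "(\<Sum>i\<le>m. \<alpha> i * \<nu> m) = (\<Sum>i\<le>m. \<alpha> i * \<nu> i) + (\<Sum>i\<le>m. \<alpha> i * (\<nu> m - \<nu> i))"
    unfolding sum.distrib[symmetric]
    by (intro sum.cong) (simp_all add: nu_le flip: distrib_left)
  finally have one: "(\<Sum>i\<le>m. \<alpha> i * (\<nu> m - \<nu> i)) = 1" by simp
  then have "(\<Sum>i\<le>m. \<alpha> i * (\<nu> m - \<nu> i)) \<noteq> 0" by linarith
  then obtain i where i: "i \<le> m" "\<alpha> i * (\<nu> m - \<nu> i) \<noteq> 0"
    by (rule sum.not_neutral_contains_not_neutral) auto
  have "\<alpha> i * (\<nu> m - \<nu> i) \<le> 1"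
    unfolding one[symmetric] using i by (intro member_le_sum) auto
  with i(2) have "\<alpha> i * (\<nu> m - \<nu> i) = 1" by linarith
  then have "\<nu> m - \<nu> i = 1" by simp
  then have "Suc (\<nu> i) = \<nu> m" by simp
  moreover have "i < m" using i(1) calculation by (cases "i = m") auto
  ultimately show ?thesis by blast
qed

section \<open>Explicit local rings in the presence of two consecutive exponents\<close>

locale cuspidal_sequence = exponent_sequence +
  assumes consecutive: "\<exists>i<m. Suc (\<nu> i) = \<nu> m"
begin

text \<open>Two consecutive elements e and e + 1 generate all n \<ge> e * e: if n has quotient k and
  remainder r modulo e, then r < e \<le> k, so r of the k summands e can be replaced by e + 1. If e
  = 0, the other element is 1 and generates everything.\<close>

lemma conductor: "\<exists>N. \<forall>n\<ge>N. n \<in> sgp"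
proof -
  obtain i where i: "i < m" "Suc (\<nu> i) = \<nu> m" using consecutive by blast
  define e where "e = \<nu> i"
  have "n \<in> sgp" if n: "n \<ge> e * e" for n
  proof (cases "e = 0")
    case True
    then have "\<nu> m = 1" using i by (simp add: e_def)
    then show ?thesis using nu_in_sgp[of m n] by simp
  next
    case False
    define r where "r = n mod e"
    have "r < e" using False by (simp add: r_def)
    moreover have "e \<le> n div e" using div_le_mono[OF n, of e] False by simp
    ultimately have "n = (n div e - r) * e + r * Suc e"
      by (simp add: algebra_simps r_def diff_mult_distrib)
    also have "\<dots> \<in> sgp"
      using nu_in_sgp[of i "n div e - r"] nu_in_sgp[of m r] i by (intro sgp_add) (simp_all add: e_def)
    finally show ?thesis .
  qed
  then show ?thesis by blast
qed

text \<open>Each of the \<open>d\<close> summands \<open>\<nu> m\<close> can be replaced by its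
  predecessor among the exponents, which lowers the sum by 1.\<close>

lemma wsums_top: "j \<le> d \<Longrightarrow> d * \<nu> m - j \<in> wsums d"
proof -
  assume j: "j \<le> d"
  obtain i where i: "i < m" "Suc (\<nu> i) = \<nu> m" using consecutive by blast
  have "j * \<nu> i + (d - j) * \<nu> m \<in> wsums (j + (d - j))"
    using i by (intro wsums_add nu_in_wsums) auto
  moreover have "j * \<nu> i + (d - j) * \<nu> m + j = d * \<nu> m"
  proof -
    have "j * \<nu> i + (d - j) * \<nu> m + j = j * \<nu> m + (d - j) * \<nu> m"
      by (simp flip: i(2))
    also have "\<dots> = d * \<nu> m" using j by (simp flip: add_mult_distrib)
    finally show ?thesis .
  qed
  ultimately show ?thesis using j by (metis add_diff_cancel_right' le_add_diff_inverse)
qed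

text \<open>Multiplying numerator and denominator by t^N, which is nonzero at c, moves all exponents
  past the conductor. The finitely many exponents between \<open>N\<close> and \<open>M\<close> then
  fit into one degree.\<close>

lemma local_ring_affine_eq:
  assumes "c \<noteq> (0 :: 'a::field)"
  shows "local_ring m \<nu> (affine_point m \<nu> c) = stalk_affine c"
proof
  show "local_ring m \<nu> (affine_point m \<nu> c) \<subseteq> stalk_affine c"
    unfolding local_ring_affine stalk_affine_def by blast
  show "stalk_affine c \<subseteq> local_ring m \<nu> (affine_point m \<nu> c)"
  proof
    fix f assume "f \<in> stalk_affine c"
    then obtain p q where pq: "f = to_fract p / to_fract q" "poly q c \<noteq> 0" by (rule stalk_affineE)
    obtain N where N: "\<And>n. n \<ge> N \<Longrightarrow> n \<in> sgp" using conductor by blast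
    have "\<forall>n\<in>sgp. \<exists>d. n \<in> wsums d" by (auto simp: sgp_def)
    then obtain D where D: "\<And>n. n \<in> sgp \<Longrightarrow> n \<in> wsums (D n)" by metis
    define M where "M = N + degree p + degree q"
    define d where "d = (\<Sum>n\<le>M. D n)"
    have d: "n \<in> wsums d" if "N \<le> n" "n \<le> M" for n
      using D[OF N[OF that(1)]] wsums_mono[of "D n" d] member_le_sum[of n "{..M}" D] that
      by (auto simp: d_def)
    have supp: "monom 1 N * r \<in> supported (wsums d)" if "N + degree r \<le> M" for r :: "'a poly"
      unfolding supported_def
    proof safe
      fix n assume "coeff (monom 1 N * r) n \<noteq> 0"
      then have "N \<le> n" "coeff r (n - N) \<noteq> 0" by (auto simp: coeff_monom_mult split: if_splits)
      then show "n \<in> wsums d" using le_degree[of r "n - N"] that by (intro d) auto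
    qed
    have "f = to_fract (monom 1 N * p) / to_fract (monom 1 N * q)" by (simp add: pq(1))
    moreover have "poly (monom 1 N * q) c \<noteq> 0" using pq assms by (simp add: poly_monom)
    moreover have "monom 1 N * p \<in> supported (wsums d)" "monom 1 N * q \<in> supported (wsums d)"
      by (auto intro!: supp simp: M_def)
    ultimately show "f \<in> local_ring m \<nu> (affine_point m \<nu> c)" unfolding local_ring_affine by blast
  qed
qed

text \<open>The shift goes to the top of the degree instead of past the conductor. With
  \<open>d = degree q\<close> and N = d * \<open>\<nu> m\<close> - d, both polynomials land among
  the d + 1 largest exponents, which are all available by \<open>wsums_top\<close>, and the leading
  coefficient of \<open>q\<close> lands exactly at d * \<open>\<nu> m\<close>.\<close>

lemma local_ring_infinity_eq: "local_ring m \<nu> (infinity_point m :: 'a::field ppoint) = stalk_infinity 0"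
proof
  show "local_ring m \<nu> (infinity_point m :: 'a ppoint) \<subseteq> stalk_infinity 0"
  proof
    fix f :: "'a ratfun" assume "f \<in> local_ring m \<nu> (infinity_point m)"
    then obtain d p q where pq: "f = to_fract p / to_fract q" "p \<in> supported (wsums d)"
      "coeff q (d * \<nu> m) \<noteq> 0" unfolding local_ring_infinity by blast
    have "degree p \<le> d * \<nu> m"
      using pq(2) wsums_le by (intro degree_le) (auto simp: supported_def, meson not_le)
    also have "\<dots> \<le> degree q" using pq(3) by (rule le_degree)
    finally show "f \<in> stalk_infinity 0" unfolding pq(1) using pq(3) by (intro stalk_infinityI) auto
  qed
  show "stalk_infinity 0 \<subseteq> local_ring m \<nu> (infinity_point m :: 'a ppoint)"
  proof
    fix f :: "'a ratfun" assume "f \<in> stalk_infinity 0"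
    then obtain p q where pq: "f = to_fract p / to_fract q" "q \<noteq> 0" "degree p \<le> degree q"
      by (rule stalk_infinityE) simp
    define d where "d = degree q"
    have le: "d \<le> d * \<nu> m" using nu_pos[of m] m_pos by simp
    define N where "N = d * \<nu> m - d"
    have supp: "monom 1 N * r \<in> supported (wsums d)" if "degree r \<le> d" for r :: "'a poly"
      unfolding supported_def
    proof safe
      fix n assume "coeff (monom 1 N * r) n \<noteq> 0"
      then have n: "N \<le> n" "coeff r (n - N) \<noteq> 0" by (auto simp: coeff_monom_mult split: if_splits)
      then have "n - N \<le> d" using le_degree[of r "n - N"] that by simp
      then have "n = d * \<nu> m - (d - (n - N))" using n(1) le by (simp add: N_def)
      also have "\<dots> \<in> wsums d" by (rule wsums_top) simp
      finally show "n \<in> wsums d" .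
    qed
    have "f = to_fract (monom 1 N * p) / to_fract (monom 1 N * q)" by (simp add: pq(1))
    moreover have "coeff (monom 1 N * q) (d * \<nu> m) \<noteq> 0"
      using pq le by (simp add: N_def coeff_monom_mult d_def)
    moreover have "monom 1 N * p \<in> supported (wsums d)" "monom 1 N * q \<in> supported (wsums d)"
      using pq by (auto intro!: supp) (auto simp: d_def)
    ultimately show "f \<in> local_ring m \<nu> (infinity_point m)" unfolding local_ring_infinity by blast
  qed
qed

text \<open>If 1 were in the semigroup, every natural number would be, and t would generate the
  maximal ideal. The lemma ensures that a gap exists, so that the Frobenius number is itself a
  gap.\<close>

lemma singular_cusp:
  assumes "\<not> regular_point m \<nu> (pointP :: 'a::field ppoint)"
  shows "1 \<notin> sgp"
proof
  assume "1 \<in> sgp"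
  have "n \<in> sgp" for n
    using zero_in_sgp sgp_add[OF \<open>1 \<in> sgp\<close>] by (induction n) auto
  then have "sgp = UNIV" by blast
  then have loc: "local_ring m \<nu> (pointP :: 'a ppoint) =
      {to_fract p / to_fract q | p q. coeff q 0 \<noteq> 0}"
    by (simp add: local_ring_cusp stalk_cusp_def)
  have "max_ideal m \<nu> (pointP :: 'a ppoint) = (\<lambda>f. tt * f) ` local_ring m \<nu> (pointP :: 'a ppoint)"
  proof (intro equalityI subsetI)
    fix f :: "'a ratfun" assume "f \<in> max_ideal m \<nu> pointP"
    then obtain p q where pq: "f = to_fract p / to_fract q" "coeff q 0 \<noteq> 0"
      and nonunit: "\<And>g. g \<in> local_ring m \<nu> (pointP :: 'a ppoint) \<Longrightarrow> f * g \<noteq> 1"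
      unfolding max_ideal_def loc by blast
    have "coeff p 0 = 0"
    proof (rule ccontr)
      assume p: "coeff p 0 \<noteq> 0"
      then have "to_fract q / to_fract p \<in> local_ring m \<nu> (pointP :: 'a ppoint)"
        unfolding loc by blast
      moreover have "f * (to_fract q / to_fract p) = 1" using p pq by auto
      ultimately show False using nonunit by blast
    qed
    then have "p = [:0, 1:] * synthetic_div p 0"
      using synthetic_div_correct'[of 0 p] by (simp add: poly_0_coeff_0)
    then have "to_fract p = tt * to_fract (synthetic_div p 0)"
      by (metis to_fract_mult tt_def)
    then have "f = tt * (to_fract (synthetic_div p 0) / to_fract q)" by (simp add: pq(1))
    moreover have "to_fract (synthetic_div p 0) / to_fract q \<in> local_ring m \<nu> pointP"
      unfolding loc using pq(2) by blast
    ultimately show "f \<in> (\<lambda>f. tt * f) ` local_ring m \<nu> pointP" by (rule image_eqI)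
  next
    fix f :: "'a ratfun" assume "f \<in> (\<lambda>f. tt * f) ` local_ring m \<nu> pointP"
    then obtain p q where pq: "f = tt * (to_fract p / to_fract q)" "coeff q 0 \<noteq> 0"
      unfolding loc by blast
    have f: "f = to_fract ([:0, 1:] * p) / to_fract q"
      unfolding pq(1) tt_def to_fract_mult by (rule times_divide_eq_right)
    have "f \<in> local_ring m \<nu> pointP" unfolding f loc using pq(2) by blast
    moreover have "f * g \<noteq> 1" if mem: "g \<in> local_ring m \<nu> pointP" for g
    proof
      assume one: "f * g = 1"
      obtain p' q' where g: "g = to_fract p' / to_fract q'" "coeff q' 0 \<noteq> 0"
        using mem unfolding loc by blast
      have "to_fract ([:0, 1:] * p * p') / to_fract (q * q') = to_fract 1 / to_fract 1"
        using one unfolding f g fract_mult by simp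
      moreover have "q * q' \<noteq> 0" using pq(2) g(2) by auto
      ultimately have "[:0, 1:] * p * p' = q * q'"
        using fract_eq_iff[of "q * q'" 1 "[:0, 1:] * p * p'" 1] by simp
      then have "coeff ([:0, 1:] * p * p') 0 = coeff (q * q') 0" by (rule arg_cong)
      then show False using pq(2) g(2) by (simp add: coeff_mult)
    qed
    ultimately show "f \<in> max_ideal m \<nu> pointP" unfolding max_ideal_def by blast
  qed
  moreover have "tt \<in> local_ring m \<nu> (pointP :: 'a ppoint)"
    unfolding loc tt_def by (intro CollectI exI[of _ "[:0, 1:]"] exI[of _ 1]) simp
  ultimately show False using assms unfolding regular_point_def by blast
qed

end

section \<open>Dimension of a quotient\<close>

text \<open>Gaussian elimination, by induction on the set \<open>I\<close> of equations: there are
  fewer equations than unknowns.\<close>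

lemma homogeneous_system_nontrivial:
  fixes M :: "'i \<Rightarrow> 'b \<Rightarrow> 'a::field"
  assumes "finite I" "finite B" "card I < card B"
  shows "\<exists>x. (\<exists>b\<in>B. x b \<noteq> 0) \<and> (\<forall>i\<in>I. (\<Sum>b\<in>B. x b * M i b) = 0)"
  using assms
proof (induction I arbitrary: B M rule: finite_induct)
  case empty
  then have "B \<noteq> {}" by auto
  then show ?case by (intro exI[of _ "\<lambda>_. 1"]) auto
next
  case (insert i I)
  show ?case
  proof (cases "\<forall>b\<in>B. M i b = 0")
    case True
    have "card I < card B" using insert by simp
    then obtain x where "\<exists>b\<in>B. x b \<noteq> 0" "\<forall>i\<in>I. (\<Sum>b\<in>B. x b * M i b) = 0"
      using insert.IH[OF insert.prems(1)] by blast
    then show ?thesis using True by (intro exI[of _ x]) simp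
  next
    case False
    then obtain b0 where b0: "b0 \<in> B" "M i b0 \<noteq> 0" by blast
    define B' where "B' = B - {b0}"
    have B': "finite B'" "b0 \<notin> B'" "B = insert b0 B'" "card I < card B'"
      using insert b0 by (auto simp: B'_def card_Diff_singleton)
    \<comment> \<open>Equation \<open>i\<close> is used to eliminate the unknown \<open>b0\<close>;
      the value of \<open>y\<close> at \<open>b0\<close> below is the one that equation
      \<open>i\<close> dictates.\<close>
    define M' where "M' j b = M j b - M j b0 * M i b / M i b0" for j b
    obtain x where x: "\<exists>b\<in>B'. x b \<noteq> 0" "\<forall>j\<in>I. (\<Sum>b\<in>B'. x b * M' j b) = 0"
      using insert.IH[OF B'(1,4)] by blast
    define y where "y = x(b0 := - (\<Sum>b\<in>B'. x b * M i b) / M i b0)"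
    have y: "(\<Sum>b\<in>B. y b * M j b) =
        (\<Sum>b\<in>B'. x b * M j b) - (\<Sum>b\<in>B'. x b * M i b) / M i b0 * M j b0" for j
    proof -
      have "(\<Sum>b\<in>B'. y b * M j b) = (\<Sum>b\<in>B'. x b * M j b)"
        using B'(2) by (intro sum.cong) (auto simp: y_def)
      then show ?thesis unfolding B'(3) using B'(1,2) by (simp add: y_def)
    qed
    have "(\<Sum>b\<in>B. y b * M j b) = 0" if "j \<in> insert i I" for j
    proof (cases "j = i")
      case True
      then show ?thesis using b0 by (simp add: y)
    next
      case False
      then have "j \<in> I" using that by simp
      then have "(\<Sum>b\<in>B'. x b * M j b - x b * (M j b0 * M i b / M i b0)) = 0"
        using x(2) by (simp add: M'_def right_diff_distrib)
      then show ?thesis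
        by (simp add: y sum_subtractf sum_divide_distrib sum_distrib_left mult_ac)
    qed
    moreover have "\<exists>b\<in>B. y b \<noteq> 0" using x(1) B' by (auto simp: y_def)
    ultimately show ?thesis by blast
  qed
qed

text \<open>A family that is spanning and independent modulo \<open>W\<close> attains the supremum.
  A larger independent set is impossible: expanding its members modulo \<open>W\<close> gives a
  linear system with more unknowns than equations, and a nontrivial solution is a relation modulo
  \<open>W\<close>.\<close>

lemma quot_dim_eqI:
  fixes scale :: "'a::field \<Rightarrow> 'v::ab_group_add \<Rightarrow> 'v" and e :: "'i \<Rightarrow> 'v"
  assumes mod: "module scale" and W: "module.subspace scale W"
    and fin: "finite I" and eV: "\<And>i. i \<in> I \<Longrightarrow> e i \<in> V"
    and span: "\<And>v. v \<in> V \<Longrightarrow> \<exists>c. v - (\<Sum>i\<in>I. scale (c i) (e i)) \<in> W"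
    and indep: "\<And>c. (\<Sum>i\<in>I. scale (c i) (e i)) \<in> W \<Longrightarrow> \<forall>i\<in>I. c i = 0"
  shows "quot_dim scale V W = enat (card I)"
proof -
  interpret module scale by (rule mod)
  \<comment> \<open>\<open>quot_dim\<close> counts sets of vectors, not families. A repeated value
    would give the relation with coefficients 1 and -1.\<close>
  have inj: "inj_on e I"
  proof
    fix i j assume ij: "i \<in> I" "j \<in> I" "e i = e j"
    show "i = j"
    proof (rule ccontr)
      assume "i \<noteq> j"
      define c where "c k = (if k = i then 1 else if k = j then - 1 else 0 :: 'a)" for k
      have "(\<Sum>k\<in>I. scale (c k) (e k)) = (\<Sum>k\<in>{i, j}. scale (c k) (e k))"
        using ij fin by (intro sum.mono_neutral_right) (auto simp: c_def)
      also have "\<dots> = 0" using \<open>i \<noteq> j\<close> ij(3) by (simp add: c_def)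
      also have "\<dots> \<in> W" using W by (rule subspace_0)
      finally have "c i = 0" using indep ij(1) by blast
      then show False by (simp add: c_def)
    qed
  qed
  have upper: "card B \<le> card I"
    if B: "finite B" "B \<subseteq> V" "\<forall>c. (\<Sum>b\<in>B. scale (c b) b) \<in> W \<longrightarrow> (\<forall>b\<in>B. c b = 0)" for B
  proof (rule ccontr)
    assume "\<not> card B \<le> card I"
    have "\<forall>b\<in>B. \<exists>c. b - (\<Sum>i\<in>I. scale (c i) (e i)) \<in> W" using B(2) span by blast
    then obtain C where C: "\<And>b. b \<in> B \<Longrightarrow> b - (\<Sum>i\<in>I. scale (C b i) (e i)) \<in> W" by metis
    obtain x where x: "\<exists>b\<in>B. x b \<noteq> 0" "\<forall>i\<in>I. (\<Sum>b\<in>B. x b * C b i) = 0"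
      using homogeneous_system_nontrivial[of I B "\<lambda>i b. C b i"] fin B(1) \<open>\<not> card B \<le> card I\<close>
      by auto
    have "(\<Sum>b\<in>B. scale (x b) (\<Sum>i\<in>I. scale (C b i) (e i))) =
        (\<Sum>i\<in>I. \<Sum>b\<in>B. scale (x b * C b i) (e i))"
      by (subst sum.swap) (simp add: scale_sum_right)
    also have "\<dots> = (\<Sum>i\<in>I. scale (\<Sum>b\<in>B. x b * C b i) (e i))" by (simp add: scale_sum_left)
    also have "\<dots> = 0" using x(2) by simp
    finally have "(\<Sum>b\<in>B. scale (x b) b) =
        (\<Sum>b\<in>B. scale (x b) (b - (\<Sum>i\<in>I. scale (C b i) (e i))))"
      by (simp add: scale_right_diff_distrib sum_subtractf)
    also have "\<dots> \<in> W" using C W by (intro subspace_sum subspace_scale)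
    finally show False using B(3) x(1) by blast
  qed
  have "quot_dim scale V W \<le> enat (card I)"
    unfolding quot_dim_def by (rule Sup_least) (auto dest: upper)
  moreover have "enat (card I) \<le> quot_dim scale V W"
    unfolding quot_dim_def
  proof (rule Sup_upper, intro CollectI exI conjI)
    show "enat (card I) = enat (card (e ` I))" using inj by (simp add: card_image)
    show "\<forall>c. (\<Sum>b\<in>e ` I. scale (c b) b) \<in> W \<longrightarrow> (\<forall>b\<in>e ` I. c b = 0)"
    proof (intro allI impI)
      fix c assume "(\<Sum>b\<in>e ` I. scale (c b) b) \<in> W"
      then have "(\<Sum>i\<in>I. scale (c (e i)) (e i)) \<in> W" using inj by (simp add: sum.reindex)
      then have "\<forall>i\<in>I. c (e i) = 0" by (rule indep)
      then show "\<forall>b\<in>e ` I. c b = 0" by blast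
    qed
  qed (use fin eV in auto)
  ultimately show ?thesis by (rule antisym)
qed

section \<open>Partial fractions and Laurent polynomials\<close>

text \<open>Bezout for the cofactor \<open>r\<close> of [:-c, 1:]^N and the power N + M splits the
  fraction. The surplus \<open>M\<close> makes the regular summand vanish to order at least
  \<open>M\<close> at c; M = 0 is enough at a smooth point, while at the cusp \<open>M\<close> has
  to lie past the conductor.\<close>

lemma principal_part:
  fixes x :: "'a::field ratfun"
  shows "\<exists>h N p q. poly q c \<noteq> 0 \<and>
    x = to_fract h / to_fract ([:-c, 1:] ^ N) + to_fract ([:-c, 1:] ^ M * p) / to_fract q"
proof -
  obtain p q where x: "x = to_fract p / to_fract q" "q \<noteq> 0" by (rule ratfun_cases)
  define l where "l = [:-c, 1:]"
  define N where "N = order c q"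
  obtain r where r: "q = l ^ N * r" "\<not> l dvd r"
    using order_decomp[OF x(2), of c] unfolding l_def N_def by blast
  have rc: "poly r c \<noteq> 0" using r(2) by (simp add: poly_eq_0_iff_dvd l_def)
  then obtain a b where ab: "a * r + b * l ^ (N + M) = 1"
    using bezout_linear_power[of r c "N + M"] unfolding l_def by blast
  have nz: "l ^ N \<noteq> 0" "r \<noteq> 0" using r x(2) by auto
  have "to_fract (p * a) / to_fract (l ^ N) + to_fract (l ^ M * (p * b)) / to_fract r =
      to_fract (p * a * r + l ^ M * (p * b) * l ^ N) / to_fract (l ^ N * r)"
    using nz by (rule fract_add)
  also have "p * a * r + l ^ M * (p * b) * l ^ N = p * (a * r + b * l ^ (N + M))"
    by (simp add: algebra_simps power_add)
  also have "to_fract \<dots> / to_fract (l ^ N * r) = x" by (simp only: ab x(1) r(1) mult_1_right)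
  finally show ?thesis using rc unfolding l_def by metis
qed

text \<open>Roots of the denominator are removed one at a time. At a root c other than 0, regularity
  forces the numerator to vanish too, and the common factor cancels. A root at 0 is moved into the
  power of t.\<close>

lemma laurent_polynomial:
  fixes f :: "'a::alg_closed_field ratfun"
  assumes "\<And>c. c \<noteq> 0 \<Longrightarrow> f \<in> stalk_affine c"
  shows "\<exists>h N. f = to_fract h / to_fract (monom 1 N)"
proof -
  have "\<exists>h N. f = to_fract h / to_fract (monom 1 N)"
    if "f = to_fract p / to_fract q" "q \<noteq> 0" "\<And>c. c \<noteq> 0 \<Longrightarrow> f \<in> stalk_affine c"
    for p q and f :: "'a ratfun"
    using that
  proof (induction "degree q" arbitrary: p q f rule: less_induct)
    case less
    show ?case
    proof (cases "degree q = 0")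
      case True
      then obtain k where k: "q = [:k:]" by (rule degree_eq_zeroE)
      then have "f = to_fract (smult (inverse k) p) / to_fract (monom 1 0)"
        unfolding less.prems(1) using less.prems(2)
        by (subst fract_eq_iff) auto
      then show ?thesis by blast
    next
      case False
      then obtain c where c: "poly q c = 0" using alg_closed_imp_poly_has_root[of q] by auto
      define l where "l = [:-c, 1:]"
      obtain q1 where q1: "q = l * q1" using c by (auto simp: poly_eq_0_iff_dvd l_def)
      then have nz: "q1 \<noteq> 0" "l \<noteq> 0" using less.prems(2) by auto
      have deg: "degree q1 < degree q" unfolding q1 using nz degree_mult_eq[of l q1] by (simp add: l_def del: mult_pCons_left)
      show ?thesis
      proof (cases "c = 0")
        case True
        then have l: "l = monom 1 1" by (simp add: l_def monom_altdef)
        \<comment> \<open>Here the function itself changes: the induction is applied to t * f, which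
          is still regular away from 0.\<close>
        have eq: "to_fract l * f = to_fract p / to_fract q1"
          using nz by (simp add: less.prems(1) q1)
        obtain h N where "to_fract l * f = to_fract h / to_fract (monom 1 N)"
          using less.hyps[OF deg eq nz(1)] less.prems(3) stalk_affine_mult to_fract_in_stalk_affine
          by metis
        then have "f = to_fract h / to_fract (monom 1 N) / to_fract l"
          using nz(2) by (simp add: field_simps)
        also have "\<dots> = to_fract h / to_fract (monom 1 N * l)" by simp
        also have "monom 1 N * l = monom 1 (N + 1)" by (simp add: l mult_monom)
        finally show ?thesis by blast
      next
        case False
        then obtain p' q' where pq': "f = to_fract p' / to_fract q'" "poly q' c \<noteq> 0"
          using less.prems(3) by (metis stalk_affineE)
        have "q' \<noteq> 0" using pq' by auto
        then have "p * q' = p' * q" using pq' less.prems fract_eq_iff by metis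
        then have "poly (p * q') c = poly (p' * q) c" by simp
        then have "poly p c = 0" using pq' c by simp
        then obtain p1 where "p = l * p1" by (auto simp: poly_eq_0_iff_dvd l_def)
        then have "f = to_fract p1 / to_fract q1" using nz by (simp add: less.prems(1) q1)
        then show ?thesis using less.hyps[OF deg _ nz(1)] less.prems(3) by blast
      qed
    qed
  qed
  moreover obtain p q where "f = to_fract p / to_fract q" "q \<noteq> 0" by (rule ratfun_cases)
  ultimately show ?thesis using assms by blast
qed

text \<open>Clearing denominators gives q * h = p * t^N, and \<open>supported_cancel\<close> removes
  \<open>q\<close>, whose constant term is nonzero. Membership in the stalk thus becomes a condition
  on each monomial of the Laurent polynomial.\<close>

lemma laurent_in_stalk_cusp:
  assumes "to_fract h / to_fract (monom 1 N) \<in> stalk_cusp S E"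
    and "\<And>s e. s \<in> S \<Longrightarrow> e \<in> E \<Longrightarrow> s + e \<in> E"
  shows "h \<in> supported ((+) N ` E)"
proof -
  obtain p q where pq: "to_fract h / to_fract (monom 1 N) = to_fract p / to_fract q"
    "p \<in> supported E" "q \<in> supported S" "coeff q 0 \<noteq> 0" using assms(1) by (rule stalk_cuspE)
  have nz: "monom 1 N \<noteq> (0 :: 'a poly)" "q \<noteq> 0" using pq(4) by auto
  have "q * h = p * monom 1 N"
    using pq(1) fract_eq_iff[OF nz] by (simp add: mult.commute)
  also have "\<dots> \<in> supported ((+) N ` E)"
    using pq(2) supported_monom[of N "{N}" 1]
    by (rule supported_mult) (auto simp: add.commute)
  finally show ?thesis
  proof (rule supported_cancel[OF _ pq(3,4)])
    fix s e assume "s \<in> S" "e \<in> (+) N ` E"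
    then show "s + e \<in> (+) N ` E" using assms(2) by (auto simp: add.left_commute[of s])
  qed
qed

lemma laurent_in_stalk_infinity:
  assumes "to_fract h / to_fract (monom 1 N) \<in> stalk_infinity b"
  shows "degree h \<le> N + b"
proof -
  have "to_fract (monom 1 N) * (to_fract h / to_fract (monom 1 N)) \<in> stalk_infinity (N + b)"
    using assms by (intro stalk_infinity_mult) (simp_all add: to_fract_in_stalk_infinity_iff degree_monom_eq)
  then show ?thesis by (simp add: to_fract_in_stalk_infinity_iff)
qed

lemma stalk_infinity_decomp: "\<exists>s. x - to_fract s \<in> stalk_infinity 0"
proof -
  obtain p q where x: "x = to_fract p / to_fract q" "q \<noteq> 0" by (rule ratfun_cases)
  have "to_fract p = to_fract (p div q) * to_fract q + to_fract (p mod q)"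
    by (simp flip: to_fract_mult to_fract_add)
  then have "x - to_fract (p div q) = to_fract (p mod q) / to_fract q"
    using x by (simp add: field_simps)
  also have "\<dots> \<in> stalk_infinity 0"
    using degree_mod_less[OF x(2), of p] x(2) by (intro stalk_infinityI) auto
  finally show ?thesis by blast
qed

section \<open>Generated sheaves\<close>

lemma gen_sheaf_subset:
  assumes "0 \<in> M" "\<And>f g. f \<in> M \<Longrightarrow> g \<in> M \<Longrightarrow> f + g \<in> M"
    and "\<And>g b. b \<in> B \<Longrightarrow> g \<in> local_ring m \<nu> R \<Longrightarrow> g * b \<in> M"
  shows "gen_sheaf m \<nu> B R \<subseteq> M"
  unfolding gen_sheaf_def using assms by (auto intro!: sum_induct_in)

context cuspidal_sequence
begin

lemma stalk_cusp_0 [simp]: "0 \<in> stalk_cusp sgp E"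
  using stalk_cuspI[of 0 E 1 sgp] zero_in_sgp by (simp add: supported_1)

lemma monom_in_stalk_cusp: "i \<in> E \<Longrightarrow> to_fract (monom c i) \<in> stalk_cusp sgp E"
  using stalk_cuspI[of "monom c i" E 1 sgp] zero_in_sgp by (simp add: supported_1 supported_monom)

lemma local_ring_add:
  "R \<in> curve m \<nu> \<Longrightarrow> f \<in> local_ring m \<nu> R \<Longrightarrow> g \<in> local_ring m \<nu> R \<Longrightarrow>
     f + g \<in> local_ring m \<nu> (R :: 'a::field ppoint)"
  by (erule curve_cases)
    (auto simp: local_ring_cusp local_ring_infinity_eq local_ring_affine_eq
      intro: stalk_cusp_add stalk_infinity_add stalk_affine_add sgp_add)

lemma local_ring_mult:
  "R \<in> curve m \<nu> \<Longrightarrow> f \<in> local_ring m \<nu> R \<Longrightarrow> g \<in> local_ring m \<nu> R \<Longrightarrow>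
     f * g \<in> local_ring m \<nu> (R :: 'a::field ppoint)"
  using stalk_infinity_mult[of f 0 g 0]
  by (erule_tac curve_cases)
    (auto simp: local_ring_cusp local_ring_infinity_eq local_ring_affine_eq
      intro: stalk_cusp_mult stalk_affine_mult sgp_add)

lemma const_in_local_ring:
  assumes "R \<in> curve m \<nu>"
  shows "const c \<in> local_ring m \<nu> (R :: 'a::field ppoint)"
  using assms
proof (cases rule: curve_cases)
  case 1
  then show ?thesis using monom_in_stalk_cusp[OF zero_in_sgp, of c]
    by (simp add: local_ring_cusp const_def monom_0)
qed (simp_all add: local_ring_infinity_eq local_ring_affine_eq const_def to_fract_in_stalk_infinity_iff)

lemma zero_in_local_ring: "R \<in> curve m \<nu> \<Longrightarrow> 0 \<in> local_ring m \<nu> (R :: 'a::field ppoint)"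
  using const_in_local_ring[of R 0] by simp

lemma one_in_local_ring: "R \<in> curve m \<nu> \<Longrightarrow> 1 \<in> local_ring m \<nu> (R :: 'a::field ppoint)"
  using const_in_local_ring[of R 1] by simp

lemma gen_sheaf_0: "R \<in> curve m \<nu> \<Longrightarrow> 0 \<in> gen_sheaf m \<nu> B (R :: 'a::field ppoint)"
  unfolding gen_sheaf_def using zero_in_local_ring[of R]
  by (intro CollectI exI[of _ "\<lambda>_. 0"]) simp

lemma gen_sheaf_add:
  assumes "R \<in> curve m \<nu>" "f \<in> gen_sheaf m \<nu> B R" "g \<in> gen_sheaf m \<nu> B R"
  shows "f + g \<in> gen_sheaf m \<nu> B (R :: 'a::field ppoint)"
proof -
  obtain u v where "f = (\<Sum>b\<in>B. u b * b)" "\<forall>b\<in>B. u b \<in> local_ring m \<nu> R"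
    "g = (\<Sum>b\<in>B. v b * b)" "\<forall>b\<in>B. v b \<in> local_ring m \<nu> R"
    using assms unfolding gen_sheaf_def by blast
  then show ?thesis unfolding gen_sheaf_def using local_ring_add[OF assms(1)]
    by (intro CollectI exI[of _ "\<lambda>b. u b + v b"]) (simp add: sum.distrib distrib_right)
qed

lemma gen_sheaf_mult:
  assumes "R \<in> curve m \<nu>" "f \<in> local_ring m \<nu> R" "g \<in> gen_sheaf m \<nu> B R"
  shows "f * g \<in> gen_sheaf m \<nu> B (R :: 'a::field ppoint)"
proof -
  obtain v where "g = (\<Sum>b\<in>B. v b * b)" "\<forall>b\<in>B. v b \<in> local_ring m \<nu> R"
    using assms unfolding gen_sheaf_def by blast
  then show ?thesis unfolding gen_sheaf_def using local_ring_mult[OF assms(1,2)]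
    by (intro CollectI exI[of _ "\<lambda>b. f * v b"]) (simp add: sum_distrib_left mult.assoc)
qed

text \<open>Finiteness of \<open>B\<close> is what gives the defining sum its meaning, since a sum
  over an infinite set is 0 by convention.\<close>

lemma gen_sheaf_generator:
  assumes "R \<in> curve m \<nu>" "finite B" "b \<in> B"
  shows "b \<in> gen_sheaf m \<nu> B (R :: 'a::field ppoint)"
proof -
  have "(\<Sum>x\<in>B. (if x = b then 1 else 0) * x) = (\<Sum>x\<in>B. if x = b then x else 0)"
    by (intro sum.cong) auto
  also have "\<dots> = b" using assms by simp
  finally show ?thesis
    unfolding gen_sheaf_def using zero_in_local_ring[OF assms(1)] one_in_local_ring[OF assms(1)]
    by (intro CollectI exI[of _ "\<lambda>x. if x = b then 1 else 0"]) simp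
qed

lemma gen_sheaf_generator_mult:
  assumes "R \<in> curve m \<nu>" "finite B" "b \<in> B" "g \<in> local_ring m \<nu> R"
  shows "g * b \<in> gen_sheaf m \<nu> B (R :: 'a::field ppoint)"
  using gen_sheaf_mult[OF assms(1,4) gen_sheaf_generator[OF assms(1-3)]] .

section \<open>The first cohomology\<close>

text \<open>An ordinary principal part at 0 leaves a remainder t^M * p / q whose denominator may
  contain gaps. Multiplying by an inverse \<open>a\<close> of \<open>q\<close> modulo t^M turns the
  denominator into 1 plus terms past the conductor.\<close>

lemma cusp_decomp:
  fixes x :: "'a::field ratfun"
  shows "\<exists>h N. x - to_fract h / to_fract (monom 1 N) \<in> stalk_cusp sgp sgp"
proof -
  obtain M0 where M0: "\<And>n. n \<ge> M0 \<Longrightarrow> n \<in> sgp" using conductor by blast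
  \<comment> \<open>The successor makes \<open>M\<close> positive, so that the constant coefficient
    of a * q is 1.\<close>
  define M where "M = Suc M0"
  have supp: "monom 1 M * r \<in> supported sgp" for r :: "'a poly"
    using M0 by (auto simp: supported_def coeff_monom_mult M_def split: if_splits)
  obtain h N p q where x: "poly q 0 \<noteq> 0"
    "x = to_fract h / to_fract ([:-0, 1:] ^ N) + to_fract ([:-0, 1:] ^ M * p) / to_fract q"
    using principal_part[of 0 x M] by blast
  have X: "[:-0, 1:] ^ n = monom (1 :: 'a) n" for n by (simp add: monom_altdef)
  obtain a b where ab: "a * q + b * monom 1 M = 1"
    using bezout_linear_power[OF x(1), of M] unfolding X by blast
  have aq: "a * q = 1 + monom 1 M * (- b)" using ab by (simp add: algebra_simps)
  have "to_fract (monom 1 M * p) / to_fract q = to_fract (monom 1 M * (p * a)) / to_fract (a * q)"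
  proof -
    have "coeff (a * q) 0 = 1" by (simp add: aq coeff_monom_mult M_def)
    then have "a * q \<noteq> 0" by auto
    then show ?thesis by (subst fract_eq_iff) (auto simp: mult_ac)
  qed
  also have "\<dots> \<in> stalk_cusp sgp sgp"
  proof (rule stalk_cuspI)
    show "a * q \<in> supported sgp"
      unfolding aq by (intro supported_add supp supported_1 zero_in_sgp)
    show "coeff (a * q) 0 \<noteq> 0" by (simp add: aq coeff_monom_mult M_def)
  qed (rule supp)
  finally show ?thesis using x(2) unfolding X by (intro exI[of _ h] exI[of _ N]) simp
qed

text \<open>Partial fractions move every family to one supported at the cusp. There the exponents in \<open>E\<close>
  vanish because they lie in the stalk, and the exponents \<open>\<le> b\<close> because they are sections away from
  the cusp.\<close>

lemma h1_eq:
  fixes F :: "'a::alg_closed_field subsheaf"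
  assumes aff: "\<And>c. c \<noteq> 0 \<Longrightarrow> F (affine_point m \<nu> c) = stalk_affine c"
    and inf: "F (infinity_point m) = stalk_infinity b"
    and cusp: "F pointP = stalk_cusp sgp E"
    and E: "sgp \<subseteq> E" "\<And>s e. s \<in> sgp \<Longrightarrow> e \<in> E \<Longrightarrow> s + e \<in> E"
  shows "h1 m \<nu> F = enat (card {l. l > b \<and> l \<notin> E})"
proof -
  define I where "I = {l. l > b \<and> l \<notin> E}"
  \<comment> \<open>The families with the single entry t^l at the cusp, l in \<open>I\<close>, will
    form a basis of the cokernel.\<close>
  define e :: "nat \<Rightarrow> 'a ppoint \<Rightarrow> 'a ratfun" where "e l R = (if R = pointP then tt ^ l else 0)" for l R
  define sc :: "'a \<Rightarrow> ('a ppoint \<Rightarrow> 'a ratfun) \<Rightarrow> ('a ppoint \<Rightarrow> 'a ratfun)"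
    where "sc c r R = smul c (r R)" for c r R
  interpret smul: module "smul :: 'a \<Rightarrow> 'a ratfun \<Rightarrow> 'a ratfun" by (rule module_smul)
  obtain N where "\<And>n. n \<ge> N \<Longrightarrow> n \<in> sgp" using conductor by blast
  then have finI: "finite I" using E(1) by (intro finite_subset[of I "{..N}"]) (auto simp: I_def, meson in_mono nat_le_linear)
  have pP: "(pointP :: 'a ppoint) \<in> curve m \<nu>" and pQ: "(infinity_point m :: 'a ppoint) \<in> curve m \<nu>"
    and pA: "affine_point m \<nu> c \<in> curve m \<nu>" for c :: 'a
    unfolding pointP_eq curve_eq by auto
  note neq = affine_neq_infinity affine_neq_cusp infinity_neq_cusp infinity_neq_cusp[symmetric]
  have F_0: "0 \<in> F R" if "R \<in> curve m \<nu>" for R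
    using that
    by (cases rule: curve_cases)
      (auto simp: aff inf cusp)
  have F_add: "f + g \<in> F R" if "R \<in> curve m \<nu>" "f \<in> F R" "g \<in> F R" for R f g
    using that
    by (cases rule: curve_cases)
      (auto simp: aff inf cusp intro: stalk_affine_add stalk_infinity_add stalk_cusp_add sgp_add E(2))
  have F_smul: "smul c f \<in> F R" if R: "R \<in> curve m \<nu>" "f \<in> F R" for R f c
    using R(1)
  proof (cases rule: curve_cases)
    case 1
    have "const c \<in> stalk_cusp sgp sgp" using const_in_local_ring[OF pP] by (simp add: local_ring_cusp)
    then show ?thesis using R(2) unfolding 1 cusp smul_def
      by (rule stalk_cusp_mult) (auto intro: E(2) sgp_add)
  next
    case 2
    have "const c \<in> stalk_infinity 0" by (simp add: const_def to_fract_in_stalk_infinity_iff)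
    then show ?thesis using stalk_infinity_mult[of "const c" 0 f b] R(2) unfolding 2 inf smul_def by simp
  next
    case (3 d)
    then show ?thesis using R(2) by (simp add: aff smul_def const_def stalk_affine_mult)
  qed
  have "quot_dim sc (finite_families m \<nu> F) (principal_families m \<nu> F) = enat (card I)"
  proof (rule quot_dim_eqI)
    show mod: "module sc"
      by unfold_locales
        (auto simp: sc_def fun_eq_iff smul.scale_right_distrib smul.scale_left_distrib)
    show "module.subspace sc (principal_families m \<nu> F)"
      unfolding module.subspace_def[OF mod]
    proof (intro conjI ballI allI)
      show "0 \<in> principal_families m \<nu> F"
        unfolding principal_families_def using F_0 by (intro CollectI exI[of _ 0]) simp
      fix r assume "r \<in> principal_families m \<nu> F"
      then obtain f where f: "\<forall>R\<in>curve m \<nu>. r R - f \<in> F R" by (auto simp: principal_families_def)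
      show "sc c r \<in> principal_families m \<nu> F" for c
        unfolding principal_families_def
        using F_smul f by (intro CollectI exI[of _ "smul c f"]) (simp add: sc_def flip: smul.scale_right_diff_distrib)
      fix r' assume "r' \<in> principal_families m \<nu> F"
      then obtain f' where f': "\<forall>R\<in>curve m \<nu>. r' R - f' \<in> F R" by (auto simp: principal_families_def)
      have "(r + r') R - (f + f') \<in> F R" if "R \<in> curve m \<nu>" for R
        using F_add[OF that, of "r R - f" "r' R - f'"] f f' that by (simp add: algebra_simps)
      then show "r + r' \<in> principal_families m \<nu> F" unfolding principal_families_def by blast
    qed
    show "finite I" by (rule finI)
    show "e l \<in> finite_families m \<nu> F" for l
    proof -
      have "{R \<in> curve m \<nu>. e l R \<notin> F R} \<subseteq> {pointP}" using F_0 by (auto simp: e_def)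
      then show ?thesis unfolding finite_families_def using finite_subset by blast
    qed
  next
    fix r assume "r \<in> finite_families m \<nu> F"
    then have fin: "finite {R \<in> curve m \<nu>. r R \<notin> F R}" by (simp add: finite_families_def)
    define A where "A = {R \<in> range (affine_point m \<nu>) - {pointP}. r R \<notin> F R}"
    have finA: "finite A" using fin by (rule rev_finite_subset) (auto simp: A_def curve_eq)
    \<comment> \<open>The principal part at R has no pole at any other affine point, so the
      principal parts at the finitely many bad points can be added without disturbing each
      other.\<close>
    have "\<exists>f. r R - f \<in> F R \<and> (\<forall>c. affine_point m \<nu> c \<noteq> R \<longrightarrow> f \<in> stalk_affine c)"
      if RA: "R \<in> A" for R
    proof -
      obtain c where c: "R = affine_point m \<nu> c" "c \<noteq> 0" using RA by (auto simp: A_def pointP_eq)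
      obtain h k p q where pq: "poly q c \<noteq> 0"
        "r R = to_fract h / to_fract ([:-c, 1:] ^ k) + to_fract ([:-c, 1:] ^ 0 * p) / to_fract q"
        using principal_part[of c "r R" 0] by blast
      define f where "f = to_fract h / to_fract ([:-c, 1:] ^ k)"
      have "r R - f = to_fract p / to_fract q" by (simp add: pq(2) f_def)
      then have "r R - f \<in> F R" using stalk_affineI[OF pq(1)] by (simp add: c aff)
      moreover have "f \<in> stalk_affine d" if "affine_point m \<nu> d \<noteq> R" for d
        using that unfolding f_def by (intro stalk_affineI) (auto simp: c poly_power)
      ultimately show ?thesis by blast
    qed
    then obtain f where f: "\<And>R. R \<in> A \<Longrightarrow> r R - f R \<in> F R"
      "\<And>R c. R \<in> A \<Longrightarrow> affine_point m \<nu> c \<noteq> R \<Longrightarrow> f R \<in> stalk_affine c" by metis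
    define f1 where "f1 = sum f A"
    have f1: "r (affine_point m \<nu> c) - f1 \<in> stalk_affine c" if "c \<noteq> 0" for c
    proof -
      define R where "R = affine_point m \<nu> c"
      have rest: "- sum f (A - {R}) \<in> stalk_affine c"
        using f(2) by (intro stalk_affine_uminus stalk_affine_sum) (auto simp: R_def)
      have FR: "F R = stalk_affine c" using aff[OF that] by (simp add: R_def)
      show ?thesis
      proof (cases "R \<in> A")
        case True
        then have "r R - f1 = (r R - f R) + (- sum f (A - {R}))"
          using finA by (simp add: f1_def sum.remove[of A R])
        also have "\<dots> \<in> stalk_affine c"
          using f(1)[OF True] rest unfolding FR by (rule stalk_affine_add)
        finally show ?thesis by (simp add: R_def)
      next
        case False
        then have "r R \<in> stalk_affine c"
          using affine_neq_cusp[OF that] FR by (auto simp: A_def R_def)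
        then have "r R + (- sum f (A - {R})) \<in> stalk_affine c" using rest by (rule stalk_affine_add)
        then show ?thesis using False by (simp add: R_def f1_def)
      qed
    qed
    \<comment> \<open>The polynomial \<open>s\<close> repairs infinity without creating a pole at
      any affine point. Its effect at the cusp is harmless because the cusp is treated last.\<close>
    obtain s where s: "r (infinity_point m) - f1 - to_fract s \<in> stalk_infinity 0"
      using stalk_infinity_decomp by blast
    define f2 where "f2 = f1 + to_fract s"
    obtain h k where hk: "r pointP - f2 - to_fract h / to_fract (monom 1 k) \<in> stalk_cusp sgp sgp"
      using cusp_decomp by blast
    \<comment> \<open>The part of h / t^k of degree at most \<open>b\<close> is regular at every c
      other than 0 and admissible at infinity, so it joins the global function \<open>f3\<close>.
      The cutoff at k + b + 1 keeps exponent \<open>b\<close> itself in this part; \<open>w\<close>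
      carries only exponents above \<open>b\<close>.\<close>
    define lo where "lo = poly_cutoff (Suc (k + b)) h"
    define w where "w = monom 1 (Suc b) * poly_shift (Suc (k + b)) h"
    have "h = lo + monom 1 k * w"
      by (rule poly_eqI) (auto simp: lo_def w_def coeff_poly_cutoff coeff_poly_shift coeff_monom_mult)
    then have h: "to_fract h / to_fract (monom 1 k) = to_fract lo / to_fract (monom 1 k) + to_fract w"
      by (simp add: add_divide_distrib)
    define f3 where "f3 = f2 + to_fract lo / to_fract (monom 1 k)"
    define wI where "wI = (\<Sum>l\<in>I. monom (coeff w l) l)"
    \<comment> \<open>An exponent of \<open>w\<close> exceeds \<open>b\<close>, so if it is not in
      \<open>I\<close> it must be in \<open>E\<close>.\<close>
    have wE: "w - wI \<in> supported E"
      unfolding supported_def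
    proof safe
      fix l assume *: "coeff (w - wI) l \<noteq> 0"
      have "coeff wI l = (if l \<in> I then coeff w l else 0)"
        using finI by (simp add: wI_def coeff_sum sum.delta')
      with * have "l \<notin> I" "coeff w l \<noteq> 0" by (auto split: if_splits)
      moreover from this have "l > b" by (auto simp: w_def coeff_monom_mult split: if_splits)
      ultimately show "l \<in> E" by (auto simp: I_def)
    qed
    define v where "v = r - (\<Sum>l\<in>I. sc (coeff w l) (e l))"
    have v: "v R = r R - (if R = pointP then to_fract wI else 0)" for R
    proof -
      have "(\<Sum>l\<in>I. sc (coeff w l) (e l)) R = (\<Sum>l\<in>I. sc (coeff w l) (e l) R)"
        by (induction I rule: infinite_finite_induct) auto
      also have "\<dots> = (if R = pointP then to_fract wI else 0)"
        by (simp add: sc_def e_def wI_def smul_tt_power)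
      finally show ?thesis by (simp add: v_def)
    qed
    have "v R - f3 \<in> F R" if "R \<in> curve m \<nu>" for R
      using that
    proof (cases rule: curve_cases)
      case 1
      have "v R - f3 = (r pointP - f2 - to_fract h / to_fract (monom 1 k)) + to_fract (w - wI)"
        by (simp add: 1 v f3_def h)
      also have "\<dots> \<in> stalk_cusp sgp E"
      proof (rule stalk_cusp_add)
        show "r pointP - f2 - to_fract h / to_fract (monom 1 k) \<in> stalk_cusp sgp E"
          using hk stalk_cusp_mono[OF E(1)] by blast
        show "to_fract (w - wI) \<in> stalk_cusp sgp E"
          using stalk_cuspI[OF wE supported_1[OF zero_in_sgp]] by simp
      qed (auto intro: E(2) sgp_add)
      finally show ?thesis by (simp add: 1 cusp)
    next
      case 2
      have "degree lo \<le> k + b"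
        by (rule degree_le) (auto simp: lo_def coeff_poly_cutoff)
      then have "to_fract (- lo) / to_fract (monom 1 k) \<in> stalk_infinity b"
        by (intro stalk_infinityI) (auto simp: degree_monom_eq)
      moreover have "r R - f1 - to_fract s \<in> stalk_infinity b"
        using s stalk_infinity_mono[of 0 b] 2 by blast
      ultimately have "(r R - f1 - to_fract s) + to_fract (- lo) / to_fract (monom 1 k) \<in> stalk_infinity b"
        using stalk_infinity_add by blast
      also have "(r R - f1 - to_fract s) + to_fract (- lo) / to_fract (monom 1 k) = v R - f3"
        by (simp add: 2 v f3_def f2_def neq)
      finally show ?thesis by (simp add: 2 inf)
    next
      case (3 c)
      have "to_fract (- lo) / to_fract (monom 1 k) \<in> stalk_affine c"
        using 3 by (intro stalk_affineI) (simp add: poly_monom)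
      then have "(r R - f1) + to_fract (- s) + to_fract (- lo) / to_fract (monom 1 k) \<in> stalk_affine c"
        using f1[OF 3(1)] 3(2) by (intro stalk_affine_add) (simp_all only: to_fract_in_stalk_affine)
      also have "(r R - f1) + to_fract (- s) + to_fract (- lo) / to_fract (monom 1 k) = v R - f3"
        using 3 by (simp add: v f3_def f2_def neq)
      finally show ?thesis using 3 by (simp add: aff)
    qed
    then have "v \<in> principal_families m \<nu> F" unfolding principal_families_def by blast
    then show "\<exists>c. r - (\<Sum>l\<in>I. sc (c l) (e l)) \<in> principal_families m \<nu> F"
      unfolding v_def by (intro exI[of _ "coeff w"])
  next
    fix c assume "(\<Sum>l\<in>I. sc (c l) (e l)) \<in> principal_families m \<nu> F"
    then obtain f where f: "\<And>R. R \<in> curve m \<nu> \<Longrightarrow> (\<Sum>l\<in>I. sc (c l) (e l)) R - f \<in> F R"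
      unfolding principal_families_def by blast
    define w where "w = (\<Sum>l\<in>I. monom (c l) l)"
    have v: "(\<Sum>l\<in>I. sc (c l) (e l)) R = (if R = pointP then to_fract w else 0)" for R
    proof -
      have "(\<Sum>l\<in>I. sc (c l) (e l)) R = (\<Sum>l\<in>I. sc (c l) (e l) R)"
        by (induction I rule: infinite_finite_induct) auto
      also have "\<dots> = (if R = pointP then to_fract w else 0)"
        by (simp add: sc_def e_def w_def smul_tt_power)
      finally show ?thesis .
    qed
    \<comment> \<open>The global function f must be a Laurent polynomial of degree at most
      \<open>b\<close>. It cannot cancel t^l with l > \<open>b\<close>, and for l in
      \<open>I\<close> such a term is not admissible at the cusp.\<close>
    have "- f \<in> stalk_affine d" if "d \<noteq> 0" for d
      using f[OF pA, of d] that by (simp add: v aff neq)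
    then obtain h k where h: "- f = to_fract h / to_fract (monom 1 k)"
      using laurent_polynomial[of "- f"] by blast
    have "- f \<in> stalk_infinity b" using f[OF pQ] by (simp add: v inf neq)
    then have deg: "degree h \<le> k + b" unfolding h by (rule laurent_in_stalk_infinity)
    have "to_fract w + - f \<in> stalk_cusp sgp E" using f[OF pP] by (simp add: v cusp)
    also have "to_fract w + - f = to_fract (monom 1 k * w + h) / to_fract (monom 1 k)"
      unfolding h by (simp add: add_divide_distrib)
    finally have supp: "monom 1 k * w + h \<in> supported ((+) k ` E)"
      by (rule laurent_in_stalk_cusp) (rule E(2))
    show "\<forall>l\<in>I. c l = 0"
    proof
      fix l assume l: "l \<in> I"
      have "coeff h (k + l) = 0" using deg l by (intro coeff_eq_0) (simp add: I_def)
      moreover have "coeff w l = c l" using finI l by (simp add: w_def coeff_sum sum.delta')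
      ultimately have "coeff (monom 1 k * w + h) (k + l) = c l" by (simp add: coeff_monom_mult)
      moreover have "k + l \<notin> (+) k ` E" using l by (auto simp: I_def)
      then have "coeff (monom 1 k * w + h) (k + l) = 0"
        using supp unfolding supported_def by blast
      ultimately show "c l = 0" by (simp only:)
    qed
  qed
  then show ?thesis unfolding h1_def sc_def[abs_def] I_def .
qed

end

section \<open>Homomorphisms into the dualizing sheaf, first cohomology and the Clifford
  index\<close>

theorem mainTheorem4:
  fixes m :: nat and \<nu> :: "nat \<Rightarrow> nat" and n :: nat and a :: "nat \<Rightarrow> nat"
    and S G G' :: "nat set" and \<gamma> :: nat
    and \<F> :: "'a::alg_closed_field subsheaf"
  assumes "monomial_curve TYPE('a) m \<nu>"
    and "unicuspidal TYPE('a) m \<nu>"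
    and "arith_genus TYPE('a) m \<nu> \<ge> 4"
    and "n \<ge> 1" and "0 < a 1" and "strict_mono_on {1..n} a"
    and "S = semigroup_of TYPE('a) m \<nu>"
    and "G = gaps TYPE('a) m \<nu>"
    and "\<gamma> = frobenius TYPE('a) m \<nu>"
    and "\<F> = gen_sheaf m \<nu> (insert 1 ((\<lambda>i. tt ^ a i) ` {1..n}))"
    and "G' = {l \<in> G. l > a n \<and> l \<notin> (\<Union>i\<in>{1..n}. (\<lambda>s. a i + s) ` S)}"
  shows "Hom_sheaf m \<nu> \<F> (dualizing m \<nu>)
             = module.span smul ((\<lambda>i. tt ^ i) ` ((\<lambda>l. \<gamma> - l) ` G'))
         \<and> h1 m \<nu> \<F> = enat (card G')
         \<and> (contributes_to_Clifford m \<nu> \<F> \<longleftrightarrow> card G' \<ge> 2)"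
proof -
  interpret exponent_sequence m \<nu>
    using assms(1) by unfold_locales (auto simp: monomial_curve_def)
  have "(infinity_point m :: 'a ppoint) \<in> curve m \<nu>" by (simp add: curve_eq)
  then have "regular_point m \<nu> (infinity_point m :: 'a ppoint)"
    using assms(2) infinity_neq_cusp by (auto simp: unicuspidal_def)
  moreover have "function_field m \<nu> = (UNIV :: 'a ratfun set)"
    using assms(1) by (simp add: monomial_curve_def)
  ultimately interpret cuspidal_sequence m \<nu>
    using regular_at_infinity by unfold_locales blast
  interpret smul: module "smul :: 'a \<Rightarrow> 'a ratfun \<Rightarrow> 'a ratfun" by (rule module_smul)
  have S: "S = sgp" using assms(7) by (simp add: semigroup_of_eq)
  have G: "G = - sgp" using assms(8) by (simp add: gaps_def semigroup_of_eq Compl_eq_Diff_UNIV)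
  have \<gamma>: "\<gamma> = Max G" using assms(8,9) by (simp add: frobenius_def)
  obtain N where N: "\<And>n. n \<ge> N \<Longrightarrow> n \<in> sgp" using conductor by blast
  have finG: "finite G"
    unfolding G by (rule finite_subset[of _ "{..N}"]) (use N in \<open>auto, meson nat_le_linear\<close>)
  have "\<not> regular_point m \<nu> (pointP :: 'a ppoint)"
    using assms(2) by (auto simp: unicuspidal_def)
  then have oneG: "1 \<in> G" unfolding G using singular_cusp by blast
  have \<gamma>G: "\<gamma> \<in> G" using oneG finG unfolding \<gamma> by (intro Max_in) auto
  have le_\<gamma>: "l \<le> \<gamma>" if "l \<in> G" for l using that finG unfolding \<gamma> by simp
  have pos_G: "l \<ge> 1" if "l \<in> G" for l
    using that zero_in_sgp by (cases l) (auto simp: G)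
  have a_mono: "a i \<le> a j" if "i \<in> {1..n}" "j \<in> {1..n}" "i \<le> j" for i j
    using assms(6) that by (cases "i = j") (auto simp: strict_mono_on_def less_imp_le)
  have a_le: "a i \<le> a n" if "i \<in> {1..n}" for i using a_mono[of i n] that by auto
  have n_mem: "n \<in> {1..n}" "1 \<in> {1..n}" using assms(4) by auto

  define B :: "'a ratfun set" where "B = insert 1 ((\<lambda>i. tt ^ a i) ` {1..n})"
  have finB: "finite B" by (simp add: B_def)
  have F: "\<F> = gen_sheaf m \<nu> B" using assms(10) by (simp add: B_def)
  have B_cases: "b = 1 \<or> (\<exists>i\<in>{1..n}. b = tt ^ a i)" if "b \<in> B" for b
    using that by (auto simp: B_def)
  have aB: "tt ^ a i \<in> B" if "i \<in> {1..n}" for i using that by (auto simp: B_def)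
  have oneB: "1 \<in> B" by (simp add: B_def)
  define E where "E = sgp \<union> (\<Union>i\<in>{1..n}. (+) (a i) ` sgp)"
  have E_add: "s + e \<in> E" if se: "s \<in> sgp" "e \<in> E" for s e
  proof (cases "e \<in> sgp")
    case True
    then show ?thesis using se sgp_add by (simp add: E_def)
  next
    case False
    then obtain i x where "i \<in> {1..n}" "x \<in> sgp" "e = a i + x" using se(2) by (auto simp: E_def)
    then have "s + e \<in> (+) (a i) ` sgp"
      using sgp_add[OF se(1)] by (intro image_eqI[of _ _ "s + x"]) auto
    then show ?thesis using \<open>i \<in> {1..n}\<close> unfolding E_def by blast
  qed
  have aE: "a i \<in> E" if "i \<in> {1..n}" for i
    using that zero_in_sgp unfolding E_def by force

  define D :: "'a ratfun set" where "D = (\<lambda>l. tt ^ (\<gamma> - l)) ` G"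
  have finD: "finite D" using finG by (simp add: D_def)
  have \<omega>: "dualizing m \<nu> = gen_sheaf m \<nu> D"
    using assms(8,9) by (simp add: dualizing_def D_def)
  \<comment> \<open>The exponents i for which the integer \<gamma> - i is outside S. The case i >
    \<gamma> is separate because natural subtraction would turn the negative difference into 0,
    which lies in S.\<close>
  define K where "K = {i. i > \<gamma> \<or> \<gamma> - i \<in> G}"
  have K_add: "s + i \<in> K" if "s \<in> sgp" "i \<in> K" for s i
  proof (rule ccontr)
    assume "s + i \<notin> K"
    then have *: "s + i \<le> \<gamma>" "\<gamma> - (s + i) \<in> sgp" by (auto simp: K_def G)
    then have "s + (\<gamma> - (s + i)) \<in> sgp" using that(1) sgp_add by blast
    moreover have "s + (\<gamma> - (s + i)) = \<gamma> - i" using * by simp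
    ultimately show False using that(2) * by (auto simp: K_def G)
  qed

  have pP: "(pointP :: 'a ppoint) \<in> curve m \<nu>" and pQ: "(infinity_point m :: 'a ppoint) \<in> curve m \<nu>"
    and pA: "affine_point m \<nu> c \<in> curve m \<nu>" for c :: 'a
    unfolding pointP_eq curve_eq by auto

  have F_aff: "\<F> (affine_point m \<nu> c) = stalk_affine c" if c: "c \<noteq> 0" for c
  proof
    show "\<F> (affine_point m \<nu> c) \<subseteq> stalk_affine c"
      unfolding F
    proof (rule gen_sheaf_subset)
      fix g b assume gb: "b \<in> B" "g \<in> local_ring m \<nu> (affine_point m \<nu> c)"
      have "b \<in> stalk_affine c"
        using B_cases[OF gb(1)] to_fract_in_stalk_affine[of 1 c] by (auto simp: tt_power)
      then show "g * b \<in> stalk_affine c"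
        using gb c by (simp add: local_ring_affine_eq stalk_affine_mult)
    qed (auto intro: stalk_affine_add)
    show "stalk_affine c \<subseteq> \<F> (affine_point m \<nu> c)"
      using gen_sheaf_generator_mult[OF pA finB oneB, of _ c] c by (auto simp: F local_ring_affine_eq)
  qed
  have F_inf: "\<F> (infinity_point m) = stalk_infinity (a n)"
  proof
    show "\<F> (infinity_point m) \<subseteq> stalk_infinity (a n)"
      unfolding F
    proof (rule gen_sheaf_subset)
      fix g b assume gb: "b \<in> B" "g \<in> local_ring m \<nu> (infinity_point m :: 'a ppoint)"
      have "b \<in> stalk_infinity (a n)"
        using B_cases[OF gb(1)] to_fract_in_stalk_infinity_iff[of 1 "a n"] a_le
        by (auto simp: tt_power to_fract_in_stalk_infinity_iff degree_monom_eq)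
      then show "g * b \<in> stalk_infinity (a n)"
        using gb stalk_infinity_mult[of g 0 b "a n"] by (simp add: local_ring_infinity_eq)
    qed (auto intro: stalk_infinity_add)
    show "stalk_infinity (a n) \<subseteq> \<F> (infinity_point m)"
    proof
      fix f :: "'a ratfun" assume "f \<in> stalk_infinity (a n)"
      then obtain p q where pq: "f = to_fract p / to_fract q" "q \<noteq> 0" "degree p \<le> degree q + a n"
        by (rule stalk_infinityE)
      \<comment> \<open>At infinity the generator of largest degree, t^(a n), generates the whole
        stalk.\<close>
      have "to_fract p / to_fract (monom 1 (a n) * q) \<in> stalk_infinity 0"
        using pq by (intro stalk_infinityI) (auto simp: degree_mult_eq degree_monom_eq)
      then have "to_fract p / to_fract (monom 1 (a n) * q) * tt ^ a n \<in> \<F> (infinity_point m)"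
        unfolding F local_ring_infinity_eq[symmetric]
        by (rule gen_sheaf_generator_mult[OF pQ finB aB[OF n_mem(1)]])
      also have "to_fract p / to_fract (monom 1 (a n) * q) * tt ^ a n = f"
        by (simp add: tt_power pq(1))
      finally show "f \<in> \<F> (infinity_point m)" .
    qed
  qed
  have F_cusp: "\<F> pointP = stalk_cusp sgp E"
  proof
    show "\<F> pointP \<subseteq> stalk_cusp sgp E"
      unfolding F
    proof (rule gen_sheaf_subset)
      fix g b assume gb: "b \<in> B" "g \<in> local_ring m \<nu> (pointP :: 'a ppoint)"
      have "tt ^ a i \<in> (stalk_cusp sgp E :: 'a ratfun set)" if "i \<in> {1..n}" for i
        unfolding tt_power using aE[OF that] by (rule monom_in_stalk_cusp)
      moreover have "1 \<in> (stalk_cusp sgp E :: 'a ratfun set)"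
        using monom_in_stalk_cusp[of 0 E 1] zero_in_sgp by (simp add: E_def)
      ultimately have "b \<in> stalk_cusp sgp E" using B_cases[OF gb(1)] by blast
      then show "g * b \<in> stalk_cusp sgp E"
        using gb E_add sgp_add unfolding local_ring_cusp by (intro stalk_cusp_mult) auto
    qed (auto intro: stalk_cusp_add E_add sgp_add)
    show "stalk_cusp sgp E \<subseteq> \<F> pointP"
    proof
      fix f :: "'a ratfun" assume "f \<in> stalk_cusp sgp E"
      then obtain p q where pq: "f = to_fract p / to_fract q" "p \<in> supported E"
        "q \<in> supported sgp" "coeff q 0 \<noteq> 0" by (rule stalk_cuspE)
      have summand: "to_fract (monom (coeff p i) i) / to_fract q \<in> \<F> pointP" for i
      proof (cases "coeff p i = 0")
        case True
        then show ?thesis using gen_sheaf_0[OF pP] by (simp add: F)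
      next
        case False
        then have "i \<in> E" using pq(2) by (auto simp: supported_def)
        then consider "i \<in> sgp" | j s where "j \<in> {1..n}" "i = a j + s" "s \<in> sgp"
          unfolding E_def by blast
        \<comment> \<open>Every exponent in \<open>E\<close> is that of a generator plus an element
          of the semigroup; the generator 1 is t^0. The numerator can thus be treated monomial by
          monomial over the fixed denominator.\<close>
        then have "\<exists>b s. tt ^ b \<in> B \<and> i = b + s \<and> s \<in> sgp"
        proof cases
          case 1
          then show ?thesis using oneB by (intro exI[of _ 0] exI[of _ i]) simp
        next
          case (2 j s)
          then show ?thesis using aB by blast
        qed
        then obtain b s where bs: "tt ^ b \<in> B" "i = b + s" "s \<in> sgp" by blast
        have "to_fract (monom (coeff p i) s) / to_fract q \<in> local_ring m \<nu> (pointP :: 'a ppoint)"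
          unfolding local_ring_cusp using pq bs by (intro stalk_cuspI supported_monom)
        then have "to_fract (monom (coeff p i) s) / to_fract q * tt ^ b \<in> \<F> pointP"
          unfolding F by (rule gen_sheaf_generator_mult[OF pP finB bs(1)])
        also have "to_fract (monom (coeff p i) s) / to_fract q * tt ^ b =
            to_fract (monom (coeff p i) i) / to_fract q"
          by (simp add: tt_power bs(2) mult_monom add.commute flip: to_fract_mult)
        finally show ?thesis .
      qed
      have "f = (\<Sum>i\<le>degree p. to_fract (monom (coeff p i) i) / to_fract q)"
        by (simp add: pq(1) poly_as_sum_of_monoms flip: sum_divide_distrib to_fract_sum)
      also have "\<dots> \<in> \<F> pointP"
        using summand gen_sheaf_0[OF pP] gen_sheaf_add[OF pP] by (intro sum_induct_in) (auto simp: F)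
      finally show "f \<in> \<F> pointP" .
    qed
  qed
  have G'_eq: "G' = {l. l > a n \<and> l \<notin> E}"
    using assms(11) by (auto simp: G S E_def)
  have h1: "h1 m \<nu> \<F> = enat (card G')"
    unfolding G'_eq using F_aff F_inf F_cusp _ E_add by (rule h1_eq) (auto simp: E_def)

  have \<omega>_aff: "dualizing m \<nu> (affine_point m \<nu> c) \<subseteq> stalk_affine c" if c: "c \<noteq> 0" for c :: 'a
    unfolding \<omega>
  proof (rule gen_sheaf_subset)
    fix g b assume gb: "b \<in> D" "g \<in> local_ring m \<nu> (affine_point m \<nu> c)"
    then show "g * b \<in> stalk_affine c"
      using c by (auto simp: D_def tt_power local_ring_affine_eq intro: stalk_affine_mult)
  qed (auto intro: stalk_affine_add)
  \<comment> \<open>Every gap is at least 1, because 0 lies in the semigroup; hence the generators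
    of \<omega> have degree at most \<gamma> - 1.\<close>
  have \<omega>_inf: "dualizing m \<nu> (infinity_point m) \<subseteq> (stalk_infinity (\<gamma> - 1) :: 'a ratfun set)"
    unfolding \<omega>
  proof (rule gen_sheaf_subset)
    fix g b assume gb: "b \<in> D" "g \<in> local_ring m \<nu> (infinity_point m :: 'a ppoint)"
    then have "b \<in> stalk_infinity (\<gamma> - 1)"
      using pos_G by (auto simp: D_def tt_power to_fract_in_stalk_infinity_iff degree_monom_eq intro!: diff_le_mono2)
    then show "g * b \<in> stalk_infinity (\<gamma> - 1)"
      using gb stalk_infinity_mult[of g 0 b "\<gamma> - 1"] by (simp add: local_ring_infinity_eq)
  qed (auto intro: stalk_infinity_add)
  have \<omega>_cusp: "dualizing m \<nu> pointP \<subseteq> (stalk_cusp sgp K :: 'a ratfun set)"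
    unfolding \<omega>
  proof (rule gen_sheaf_subset)
    fix g b assume gb: "b \<in> D" "g \<in> local_ring m \<nu> (pointP :: 'a ppoint)"
    then obtain l where l: "l \<in> G" "b = tt ^ (\<gamma> - l)" by (auto simp: D_def)
    then have "\<gamma> - l \<in> K" using le_\<gamma>[OF l(1)] by (simp add: K_def)
    then have "b \<in> stalk_cusp sgp K" by (simp add: l(2) tt_power monom_in_stalk_cusp)
    then show "g * b \<in> stalk_cusp sgp K"
      using gb K_add sgp_add unfolding local_ring_cusp by (intro stalk_cusp_mult) auto
  qed (auto intro: stalk_cusp_add K_add sgp_add)

  have "Hom_sheaf m \<nu> \<F> (dualizing m \<nu>) \<subseteq> module.span smul ((\<lambda>i. tt ^ i) ` ((\<lambda>l. \<gamma> - l) ` G'))"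
  proof
    fix f assume f: "f \<in> Hom_sheaf m \<nu> \<F> (dualizing m \<nu>)"
    have fB: "f * b \<in> dualizing m \<nu> R" if "R \<in> curve m \<nu>" "b \<in> B" for R b
      using f that gen_sheaf_generator[OF that(1) finB that(2)] by (auto simp: Hom_sheaf_def F)
    have "f \<in> stalk_affine c" if "c \<noteq> 0" for c
      using fB[OF pA oneB] \<omega>_aff[OF that] by auto
    then obtain h k where hk: "f = to_fract h / to_fract (monom 1 k)"
      using laurent_polynomial by blast
    have "f \<in> stalk_cusp sgp K" using fB[OF pP oneB] \<omega>_cusp by auto
    then have supp_h: "h \<in> supported ((+) k ` K)"
      unfolding hk by (rule laurent_in_stalk_cusp) (rule K_add)
    define p where "p = poly_shift k h"
    \<comment> \<open>Elements of \<open>K\<close> are nonnegative, so the condition at the cusp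
      already rules out negative exponents and f is a polynomial.\<close>
    have "h = monom 1 k * p"
      using supp_h by (intro poly_eqI) (auto simp: p_def coeff_monom_mult coeff_poly_shift supported_def)
    then have fp: "f = to_fract p" by (simp add: hk)
    \<comment> \<open>The three conditions come from testing f on the generator 1 at the cusp, on
      each t^(a j) at the cusp, and on t^(a n) at infinity.\<close>
    have p_coeff: "i \<in> K \<and> (\<forall>j\<in>{1..n}. a j + i \<in> K) \<and> a n + i \<le> \<gamma> - 1" if i: "coeff p i \<noteq> 0" for i
    proof (intro conjI ballI)
      show "i \<in> K" using i supp_h by (auto simp: p_def coeff_poly_shift supported_def)
    next
      fix j assume j: "j \<in> {1..n}"
      have "f * tt ^ a j \<in> stalk_cusp sgp K" using fB[OF pP aB[OF j]] \<omega>_cusp by blast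
      then have "to_fract (monom 1 (a j) * p) / to_fract (monom 1 0) \<in> stalk_cusp sgp K"
        by (simp add: fp tt_power mult.commute)
      then have "monom 1 (a j) * p \<in> supported ((+) 0 ` K)"
        by (rule laurent_in_stalk_cusp) (rule K_add)
      moreover have "coeff (monom 1 (a j) * p) (a j + i) \<noteq> 0" using i by (simp add: coeff_monom_mult)
      ultimately show "a j + i \<in> K" by (auto simp: supported_def)
    next
      have "f * tt ^ a n \<in> stalk_infinity (\<gamma> - 1)"
        using fB[OF pQ aB[OF n_mem(1)]] \<omega>_inf by blast
      also have "f * tt ^ a n = to_fract (monom 1 (a n) * p)" by (simp add: fp tt_power mult.commute)
      finally have "degree (monom 1 (a n) * p) \<le> \<gamma> - 1"
        by (simp only: to_fract_in_stalk_infinity_iff)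
      moreover have "a n + i \<le> degree (monom 1 (a n) * p)"
        using i by (intro le_degree) (simp add: coeff_monom_mult)
      ultimately show "a n + i \<le> \<gamma> - 1" by linarith
    qed
    have mem: "smul (coeff p i) (tt ^ i) \<in> smul.span ((\<lambda>i. tt ^ i) ` ((\<lambda>l. \<gamma> - l) ` G'))" for i
    proof (cases "coeff p i = 0")
      case True
      then show ?thesis using smul.span_zero by simp
    next
      case False
      note i = p_coeff[OF False]
      have \<gamma>1: "\<gamma> \<ge> 1" using pos_G[OF \<gamma>G] .
      have "\<gamma> - i \<in> G" using i \<gamma>1 by (auto simp: K_def)
      \<comment> \<open>The bound at infinity is the one that yields the condition l > a n for l =
        \<gamma> - i; it also keeps the subtractions exact.\<close>
      moreover have "a n < \<gamma> - i" using i \<gamma>1 by linarith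
      moreover have "\<gamma> - i \<notin> (+) (a j) ` sgp" if "j \<in> {1..n}" for j
      proof
        assume "\<gamma> - i \<in> (+) (a j) ` sgp"
        then obtain s where s: "\<gamma> - i = a j + s" "s \<in> sgp" by blast
        have "a j + i \<le> \<gamma>" using i a_le[OF that] by linarith
        moreover have "a j + i \<in> K" using i that by blast
        ultimately have "\<gamma> - (a j + i) \<in> G" by (simp add: K_def)
        moreover have "\<gamma> - (a j + i) = s" using s by simp
        ultimately show False using s by (simp add: G)
      qed
      ultimately have "\<gamma> - i \<in> G'" by (auto simp: G'_eq E_def G)
      moreover have "i = \<gamma> - (\<gamma> - i)" using i \<gamma>1 by linarith
      ultimately have "tt ^ i \<in> (\<lambda>i. tt ^ i :: 'a ratfun) ` ((\<lambda>l. \<gamma> - l) ` G')" by blast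
      then show ?thesis by (intro smul.span_scale smul.span_base)
    qed
    have "f = (\<Sum>i\<le>degree p. smul (coeff p i) (tt ^ i))"
      by (simp add: fp smul_tt_power poly_as_sum_of_monoms flip: to_fract_sum)
    also have "\<dots> \<in> smul.span ((\<lambda>i. tt ^ i) ` ((\<lambda>l. \<gamma> - l) ` G'))"
      by (intro smul.span_sum mem)
    finally show "f \<in> smul.span ((\<lambda>i. tt ^ i) ` ((\<lambda>l. \<gamma> - l) ` G'))" .
  qed
  moreover have "module.span smul ((\<lambda>i. tt ^ i) ` ((\<lambda>l. \<gamma> - l) ` G')) \<subseteq> Hom_sheaf m \<nu> \<F> (dualizing m \<nu>)"
  proof (rule smul.span_minimal)
    show "smul.subspace (Hom_sheaf m \<nu> \<F> (dualizing m \<nu>))"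
      unfolding smul.subspace_def
    proof (intro conjI ballI allI)
      show "0 \<in> Hom_sheaf m \<nu> \<F> (dualizing m \<nu>)"
        using gen_sheaf_0 by (auto simp: Hom_sheaf_def \<omega>)
    next
      fix f g assume "f \<in> Hom_sheaf m \<nu> \<F> (dualizing m \<nu>)" "g \<in> Hom_sheaf m \<nu> \<F> (dualizing m \<nu>)"
      then show "f + g \<in> Hom_sheaf m \<nu> \<F> (dualizing m \<nu>)"
        by (auto simp: Hom_sheaf_def \<omega> distrib_right intro: gen_sheaf_add)
    next
      fix c f assume "f \<in> Hom_sheaf m \<nu> \<F> (dualizing m \<nu>)"
      then show "smul c f \<in> Hom_sheaf m \<nu> \<F> (dualizing m \<nu>)"
        by (auto simp: Hom_sheaf_def \<omega> smul_def mult.assoc intro: gen_sheaf_mult const_in_local_ring)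
    qed
    show "(\<lambda>i. tt ^ i) ` ((\<lambda>l. \<gamma> - l) ` G') \<subseteq> Hom_sheaf m \<nu> \<F> (dualizing m \<nu>)"
    proof safe
      fix l assume "l \<in> G'"
      then have l: "l \<in> G" "l > a n" "l \<notin> E" using assms(11) G'_eq by auto
      \<comment> \<open>Multiplication by t^(\<gamma> - l) sends generators of F to generators of
        \<omega>. For t^(a i) the new gap is l - a i: it is a gap because l is not in a i +
        S.\<close>
      have gen: "tt ^ (\<gamma> - l) * b \<in> D" if "b \<in> B" for b
        using B_cases[OF that]
      proof
        assume "b = 1"
        then show ?thesis using l by (simp add: D_def)
      next
        assume "\<exists>i\<in>{1..n}. b = tt ^ a i"
        then obtain i where i: "i \<in> {1..n}" "b = tt ^ a i" by blast
        then have lt: "a i < l" using a_le[OF i(1)] l(2) by linarith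
        have "l - a i \<in> G"
        proof (rule ccontr)
          assume "l - a i \<notin> G"
          then have "a i + (l - a i) \<in> E" using i(1) unfolding E_def G by blast
          then show False using l(3) lt by simp
        qed
        moreover have "\<gamma> - l + a i = \<gamma> - (l - a i)" using lt le_\<gamma>[OF l(1)] by simp
        then have "tt ^ (\<gamma> - l) * b = tt ^ (\<gamma> - (l - a i))" by (simp add: i(2) flip: power_add)
        ultimately show ?thesis by (simp add: D_def)
      qed
      show "tt ^ (\<gamma> - l) \<in> Hom_sheaf m \<nu> \<F> (dualizing m \<nu>)"
        unfolding Hom_sheaf_def
      proof safe
        fix R g assume R: "R \<in> curve m \<nu>" and "g \<in> \<F> R"
        then obtain u where u: "g = (\<Sum>b\<in>B. u b * b)" "\<forall>b\<in>B. u b \<in> local_ring m \<nu> R"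
          unfolding F gen_sheaf_def by blast
        have "tt ^ (\<gamma> - l) * g = (\<Sum>b\<in>B. u b * (tt ^ (\<gamma> - l) * b))"
          by (simp add: u(1) sum_distrib_left mult.left_commute)
        also have "\<dots> \<in> dualizing m \<nu> R"
          unfolding \<omega> using gen_sheaf_0[OF R] gen_sheaf_add[OF R] u(2)
          by (intro sum_induct_in gen_sheaf_generator_mult[OF R finD gen]) auto
        finally show "tt ^ (\<gamma> - l) * g \<in> dualizing m \<nu> R" .
      qed
    qed
  qed
  \<comment> \<open>The global sections 1 and t^(a 1) are independent since a 1 > 0, so contributing
    to the Clifford index comes down to the condition on first cohomology.\<close>
  moreover have "h0 m \<nu> \<F> \<ge> 2"
  proof -
    have a1: "0 < a 1" by (rule assms(5))
    have neq: "(1 :: 'a ratfun) \<noteq> tt ^ a 1"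
    proof
      assume "1 = (tt ^ a 1 :: 'a ratfun)"
      then have "to_fract (1 :: 'a poly) = to_fract (monom 1 (a 1))" by (simp add: tt_power)
      then have "degree (1 :: 'a poly) = degree (monom (1 :: 'a) (a 1))" by (simp only: to_fract_eq_iff)
      then show False using a1 by (simp add: degree_monom_eq)
    qed
    have "{1, tt ^ a 1} \<subseteq> H0 m \<nu> \<F>"
      using gen_sheaf_generator[OF _ finB] oneB aB[OF n_mem(2)] by (auto simp: H0_def F)
    moreover have "c 1 = 0 \<and> c (tt ^ a 1) = 0"
      if "(\<Sum>b\<in>{1, tt ^ a 1}. smul (c b) b) = 0" for c :: "'a ratfun \<Rightarrow> 'a"
    proof -
      have "smul (c 1) (tt ^ 0) + smul (c (tt ^ a 1)) (tt ^ a 1) = 0" using that neq by simp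
      then have "to_fract (monom (c 1) 0 + monom (c (tt ^ a 1)) (a 1)) = 0"
        unfolding smul_tt_power to_fract_add .
      then have *: "monom (c 1) 0 + monom (c (tt ^ a 1)) (a 1) = 0" by (simp only: to_fract_eq_0_iff)
      from arg_cong[OF *, of "\<lambda>p. coeff p 0"] arg_cong[OF *, of "\<lambda>p. coeff p (a 1)"]
      show ?thesis using a1 by simp
    qed
    moreover have "card {1, tt ^ a 1 :: 'a ratfun} = 2" using neq by simp
    ultimately have "enat 2 \<le> h0 m \<nu> \<F>"
      unfolding h0_def quot_dim_def
      by (intro Sup_upper CollectI exI[of _ "{1, tt ^ a 1 :: 'a ratfun}"]) auto
    then show ?thesis by (simp add: numeral_eq_enat)
  qed
  ultimately show ?thesis
    using h1 by (auto simp: contributes_to_Clifford_def numeral_eq_enat)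
qed

end
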